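(* Let $A$ be a countably infinite set. For every $\lambda\in(0,1)$ there exist probability measures $(\rho_n)_{n\in\mathbb{Z}}$ on $A$ such that the Bernoulli shift on $\big(A^{\mathbb{Z}},\mathcal{B},\bigotimes_{n\in\mathbb{Z}}\rho_n\big)$ is of type-$\mathrm{III}_\lambda$.
   Context: The two-sided Bernoulli shift on $A$ associated with probability measures $(\rho_n)_{n\in\mathbb{Z}}$ on $A$ is the product probability space $(A^{\mathbb{Z}},\mathcal{B},\bigotimes_{n\in\mathbb{Z}}\rho_n)$ ($\mathcal{B}$ the product sigma-algebra) with the left-shift $(Ta)_i=a_{i+1}$. An action $(T_g)_{g\in G}$ of a countable group on a $\sigma$-finite measure space $(\Omega,\mathcal{F},\mu)$ is nonsingular if $\mu\circ T_g\sim\mu$ (same null sets) for all $g$; it is ergodic if every $E\in\mathcal{F}$ with $\mu(E\triangle T_g(E))=0$ for all $g\in G$ satisfies $\mu(E)=0$ or $\mu(E^c)=0$. An invertible nonsingular map $T$ is regarded as the $\mathbb{Z}$-action $(T^n)_{n\in\mathbb{Z}}$. For an ergodic nonsingular action, $r\in\mathbb{R}$ is an essential value if for all $A'\in\mathcal{F}$ with $\mu(A')>0$ and all $\epsilon>0$ there is $g\in G$ with $\mu\big(A'\cap T_g^{-1}A'\cap\{|\log\frac{d\mu\circ T_g}{d\mu}-r|<\epsilon\}\big)>0$. The Krieger ratio set $e(T)$ is the set of all essential values. For $0<\lambda<1$, the action is of type-$\mathrm{III}_\lambda$ if it is nonsingular, ergodic and $e(T)=\{n\log\lambda:n\in\mathbb{Z}\}$.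 *)

theory Defs
  imports "HOL-Probability.Probability"
begin

section \<open>Nonsingular actions of countable groups\<close>

text \<open>
  Groups are written additively, so that the action generated by a single invertible map is
  an action of \<^typ>\<open>int\<close>.
\<close>

definition measurable_action :: "'x measure \<Rightarrow> ('g::{group_add,countable} \<Rightarrow> 'x \<Rightarrow> 'x) \<Rightarrow> bool" where
  "measurable_action M T \<longleftrightarrow>
     (\<forall>g. T g \<in> measurable M M) \<and>
     (\<forall>x\<in>space M. T 0 x = x) \<and>
     (\<forall>g h. \<forall>x\<in>space M. T (g + h) x = T g (T h x))"

text \<open>
  The measure \<open>E \<mapsto> \<mu> (T\<^sub>g E)\<close>. It is the image measure of \<open>\<mu>\<close> under the inverse of \<open>T\<^sub>g\<close>;
  see the lemma \<open>emeasure_translate_measure\<close>.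
\<close>

definition translate_measure ::
  "'x measure \<Rightarrow> ('g::{group_add,countable} \<Rightarrow> 'x \<Rightarrow> 'x) \<Rightarrow> 'g \<Rightarrow> 'x measure" where
  "translate_measure M T g = distr M M (T (- g))"

lemma measurable_action_image:
  assumes "measurable_action M T" and "E \<in> sets M"
  shows "T g ` E = T (- g) -` E \<inter> space M"
proof -
  have E: "E \<subseteq> space M"
    using assms(2) by (rule sets.sets_into_space)
  have sp: "T h x \<in> space M" if "x \<in> space M" for h x
    using assms(1) that unfolding measurable_action_def by (blast dest: measurable_space)
  have inv: "T (- h) (T h x) = x" "T h (T (- h) x) = x" if "x \<in> space M" for h x
    using assms(1) that unfolding measurable_action_def
    by (metis left_minus, metis right_minus)
  show ?thesis
  proof (intro equalityI subsetI)
    fix y assume "y \<in> T g ` E"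
    then show "y \<in> T (- g) -` E \<inter> space M"
      using E sp inv by auto
  next
    fix y assume "y \<in> T (- g) -` E \<inter> space M"
    then show "y \<in> T g ` E"
      using inv(2)[of y g] by (metis IntE image_eqI vimageD)
  qed
qed

lemma emeasure_translate_measure:
  assumes "measurable_action M T" and "E \<in> sets M"
  shows "emeasure (translate_measure M T g) E = emeasure M (T g ` E)"
proof -
  have "T (- g) \<in> measurable M M"
    using assms(1) by (simp add: measurable_action_def)
  then show ?thesis
    using assms by (simp add: translate_measure_def emeasure_distr measurable_action_image)
qed

definition nonsingular_action :: "'x measure \<Rightarrow> ('g::{group_add,countable} \<Rightarrow> 'x \<Rightarrow> 'x) \<Rightarrow> bool" where
  "nonsingular_action M T \<longleftrightarrow>
     sigma_finite_measure M \<and> measurable_action M T \<and>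
     (\<forall>g. null_sets (translate_measure M T g) = null_sets M)"

definition ergodic_action :: "'x measure \<Rightarrow> ('g::{group_add,countable} \<Rightarrow> 'x \<Rightarrow> 'x) \<Rightarrow> bool" where
  "ergodic_action M T \<longleftrightarrow>
     (\<forall>E\<in>sets M. (\<forall>g. emeasure M ((E - T g ` E) \<union> (T g ` E - E)) = 0) \<longrightarrow>
        emeasure M E = 0 \<or> emeasure M (space M - E) = 0)"

text \<open>
  For a nonsingular action the Radon--Nikodym derivative is positive and finite almost
  everywhere, so the values of \<^const>\<open>enn2real\<close> at infinity and of \<^const>\<open>ln\<close> at zero are
  irrelevant below.
\<close>

definition log_derivative ::
  "'x measure \<Rightarrow> ('g::{group_add,countable} \<Rightarrow> 'x \<Rightarrow> 'x) \<Rightarrow> 'g \<Rightarrow> 'x \<Rightarrow> real" where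
  "log_derivative M T g x = ln (enn2real (RN_deriv M (translate_measure M T g) x))"

definition essential_value ::
  "'x measure \<Rightarrow> ('g::{group_add,countable} \<Rightarrow> 'x \<Rightarrow> 'x) \<Rightarrow> real \<Rightarrow> bool" where
  "essential_value M T r \<longleftrightarrow>
     (\<forall>E\<in>sets M. emeasure M E > 0 \<longrightarrow>
        (\<forall>\<epsilon>>0. \<exists>g. emeasure M (E \<inter> (T g -` E) \<inter>
            {x \<in> space M. \<bar>log_derivative M T g x - r\<bar> < \<epsilon>}) > 0))"

definition krieger_ratio_set :: "'x measure \<Rightarrow> ('g::{group_add,countable} \<Rightarrow> 'x \<Rightarrow> 'x) \<Rightarrow> real set" where
  "krieger_ratio_set M T = {r. essential_value M T r}"

definition type_III_action ::
  "real \<Rightarrow> 'x measure \<Rightarrow> ('g::{group_add,countable} \<Rightarrow> 'x \<Rightarrow> 'x) \<Rightarrow> bool" where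
  "type_III_action lam M T \<longleftrightarrow>
     0 < lam \<and> lam < 1 \<and> nonsingular_action M T \<and> ergodic_action M T \<and>
     krieger_ratio_set M T = {of_int n * ln lam | n :: int. True}"


section \<open>Single transformations\<close>

text \<open>
  The integer iterates of a self-map of \<open>X\<close>, meaningful when the map is a bijection of \<open>X\<close>.
  If it is not a bijection of \<^term>\<open>space M\<close>, the iterates violate
  \<^const>\<open>measurable_action\<close>.
\<close>

definition int_iterate :: "'x set \<Rightarrow> ('x \<Rightarrow> 'x) \<Rightarrow> int \<Rightarrow> 'x \<Rightarrow> 'x" where
  "int_iterate X f n = (if n \<ge> 0 then f ^^ nat n else inv_into X f ^^ nat (- n))"

definition type_III_map :: "real \<Rightarrow> 'x measure \<Rightarrow> ('x \<Rightarrow> 'x) \<Rightarrow> bool" where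
  "type_III_map lam M f \<longleftrightarrow> type_III_action lam M (int_iterate (space M) f)"


section \<open>Bernoulli shifts\<close>

text \<open>
  A probability measure on the countable set \<open>A\<close> is defined on all subsets of \<open>A\<close>.
\<close>

definition prob_measure_on :: "'a set \<Rightarrow> 'a measure \<Rightarrow> bool" where
  "prob_measure_on A \<rho> \<longleftrightarrow> prob_space \<rho> \<and> space \<rho> = A \<and> sets \<rho> = Pow A"

definition bernoulli_space :: "(int \<Rightarrow> 'a measure) \<Rightarrow> (int \<Rightarrow> 'a) measure" where
  "bernoulli_space \<rho> = (\<Pi>\<^sub>M n\<in>UNIV. \<rho> n)"

definition left_shift :: "(int \<Rightarrow> 'a) \<Rightarrow> int \<Rightarrow> 'a" where
  "left_shift a = (\<lambda>i. a (i + 1))"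

end

theory Submission
  imports Defs
begin

text \<open>
  Idea. The alphabet is split into a symbol of mass at least one half and countably many triples
  \<open>a\<^sub>k, b\<^sub>k, c\<^sub>k\<close> of rapidly decreasing mass \<open>m\<^sub>k, \<lambda>\<^bsup>r k\<^esup> m\<^sub>k, m\<^sub>k\<close>. All \<open>\<rho>\<^sub>j\<close> are equal
  to one measure \<open>\<nu>\<close>, except that the masses of \<open>a\<^sub>k\<close> and \<open>b\<^sub>k\<close> are exchanged for \<open>j\<close> in a window
  \<open>B\<^sub>k\<close> of length about \<open>1 / m\<^sub>k\<close>. A shift by \<open>n\<close> alters at most \<open>2 \<bar>n\<bar>\<close> coordinates of each window, so by
  Borel--Cantelli almost every derivative is a finite product of powers of \<open>\<lambda>\<close>.

  Let \<open>w, w'\<close> be words on an interval \<open>Q\<^sub>k\<close> containing \<open>B\<^sub>0, \<dots>, B\<^sub>k\<close>, and let \<open>n\<close> range over finitely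
  many well separated times that are short compared with the later windows. The events
  \<open>T\<^sup>-\<^sup>n[w']\<close> are independent of each other and of \<open>[w]\<close>, and on \<open>[w] \<inter> T\<^sup>-\<^sup>n[w']\<close> the derivative
  of \<open>T\<^sup>n\<close> depends on \<open>w\<close> and \<open>w'\<close> only, outside a set of small measure. A second moment
  estimate then shows that if \<open>E\<close> fills most of \<open>[w]\<close> and \<open>F\<close> most of \<open>[w']\<close>, then some \<open>T\<^sup>n\<close> moves a
  nonnull part of \<open>E\<close> into \<open>F\<close> with that derivative. This gives ergodicity. As most points see \<open>a\<^sub>k\<close>
  or \<open>c\<^sub>k\<close> in \<open>B\<^sub>k\<close>, any nonnull \<open>E\<close> fills most of two words differing by exchanging one \<open>c\<^sub>k\<close>
  with \<open>a\<^sub>k\<close>, for which the derivative is \<open>\<lambda>\<^bsup>r k\<^esup>\<close>; and \<open>r\<close> takes every value infinitely often.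
\<close>

section \<open>Products of discrete measures and their densities\<close>

definition box :: "'a set \<Rightarrow> int set \<Rightarrow> (int \<Rightarrow> 'a set) \<Rightarrow> (int \<Rightarrow> 'a) set" where
  "box A J X = {x. (\<forall>j. x j \<in> A) \<and> (\<forall>j\<in>J. x j \<in> X j)}"

definition cyl :: "'a set \<Rightarrow> int set \<Rightarrow> (int \<Rightarrow> 'a) \<Rightarrow> (int \<Rightarrow> 'a) set" where
  "cyl A J w = {x. (\<forall>j. x j \<in> A) \<and> (\<forall>j\<in>J. x j = w j)}"

lemma box_eq_UN_cyl: "box A J X = (\<Union>w\<in>PiE J (\<lambda>j. X j \<inter> A). cyl A J w)"
proof (intro equalityI subsetI)
  fix x assume x: "x \<in> box A J X"
  then have "restrict x J \<in> PiE J (\<lambda>j. X j \<inter> A)" "x \<in> cyl A J (restrict x J)"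
    by (auto simp: box_def cyl_def)
  then show "x \<in> (\<Union>w\<in>PiE J (\<lambda>j. X j \<inter> A). cyl A J w)" by blast
qed (auto simp: box_def cyl_def)

lemma disjoint_cyl: "disjoint_family_on (cyl A J) (PiE J X)"
proof (unfold disjoint_family_on_def, intro ballI impI)
  fix v w assume "v \<in> PiE J X" "w \<in> PiE J X" "v \<noteq> w"
  then obtain j where "j \<in> J" "v j \<noteq> w j"
    by (metis PiE_ext)
  then show "cyl A J v \<inter> cyl A J w = {}"
    by (auto simp: cyl_def)
qed

locale bernoulli =
  fixes A :: "'a set" and \<rho> :: "int \<Rightarrow> 'a measure"
  assumes countable_A: "countable A"
    and prob: "\<And>j. prob_measure_on A (\<rho> j)"
begin

abbreviation "M \<equiv> bernoulli_space \<rho>"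
abbreviation "p j a \<equiv> measure (\<rho> j) {a}"

lemma prob_space_rho: "prob_space (\<rho> j)"
  and space_rho [simp]: "space (\<rho> j) = A"
  and sets_rho [simp]: "sets (\<rho> j) = Pow A"
  using prob[of j] by (auto simp: prob_measure_on_def)

sublocale PP: product_prob_space \<rho> UNIV
  by (intro product_prob_spaceI prob_space_rho)

sublocale MM: prob_space "bernoulli_space \<rho>"
  unfolding bernoulli_space_def by unfold_locales

lemma space_M: "space M = {x. \<forall>j. x j \<in> A}"
  by (auto simp: bernoulli_space_def space_PiM)

lemma sets_rho_count: "sets (\<rho> j) = sets (count_space A)"
  by simp

lemma sets_M: "sets M = sets (PiM UNIV (\<lambda>j::int. count_space A))"
  unfolding bernoulli_space_def by (intro sets_PiM_cong) (simp_all add: sets_rho_count)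

lemma measurable_coord [measurable]: "(\<lambda>x. x j) \<in> measurable M (count_space A)"
  by (subst measurable_cong_sets[OF sets_M refl]) measurable

lemma measurable_box [measurable, intro]: "box A J X \<in> sets M"
proof -
  have "box A J X = {x \<in> space M. \<forall>j\<in>J. x j \<in> X j}"
    by (auto simp: box_def space_M)
  also have "\<dots> \<in> sets M"
  proof -
    have "{x \<in> space M. x j \<in> X j} \<in> sets M" for j
    proof -
      have "{x \<in> space M. x j \<in> X j} = (\<lambda>x. x j) -` (X j \<inter> A) \<inter> space M"
        by (auto simp: space_M)
      then show ?thesis using measurable_sets[OF measurable_coord[of j], of "X j \<inter> A"] by simp
    qed
    then show ?thesis
      by (intro sets.sets_Collect_countable_Ball) (auto intro: sets.sets_Collect)
  qed
  finally show ?thesis .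
qed

lemma measurable_cyl [measurable, intro]: "cyl A J w \<in> sets M"
proof -
  have "cyl A J w = box A J (\<lambda>j. {w j})" by (auto simp: cyl_def box_def)
  then show ?thesis by simp
qed

lemma emeasure_box:
  assumes "finite J" "\<And>j. j \<in> J \<Longrightarrow> X j \<subseteq> A"
  shows "emeasure M (box A J X) = (\<Prod>j\<in>J. emeasure (\<rho> j) (X j))"
proof -
  have "box A J X = {x \<in> space (PiM UNIV \<rho>). \<forall>j\<in>J. x j \<in> X j}"
    by (auto simp: box_def space_M[unfolded bernoulli_space_def])
  then show ?thesis
    unfolding bernoulli_space_def using assms by (simp add: PP.emeasure_PiM_Collect)
qed

lemma measure_box:
  assumes "finite J" "\<And>j. j \<in> J \<Longrightarrow> X j \<subseteq> A"
  shows "measure M (box A J X) = (\<Prod>j\<in>J. measure (\<rho> j) (X j))"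
proof -
  have "ennreal (measure M (box A J X)) = ennreal (\<Prod>j\<in>J. measure (\<rho> j) (X j))"
    using emeasure_box[OF assms] by (simp add: MM.emeasure_eq_measure PP.M.emeasure_eq_measure prod_ennreal)
  then show ?thesis by (simp add: prod_nonneg)
qed

lemma measure_cyl:
  assumes "finite J" "\<And>j. j \<in> J \<Longrightarrow> w j \<in> A"
  shows "measure M (cyl A J w) = (\<Prod>j\<in>J. p j (w j))"
proof -
  have "cyl A J w = box A J (\<lambda>j. {w j})" by (auto simp: cyl_def box_def)
  then show ?thesis using assms by (simp add: measure_box)
qed

lemma measure_cyl_Int:
  assumes "finite I" "finite J" "I \<inter> J = {}"
    and "\<And>j. j \<in> I \<Longrightarrow> u j \<in> A" "\<And>j. j \<in> J \<Longrightarrow> w j \<in> A"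
  shows "measure M (cyl A I u \<inter> cyl A J w) = (\<Prod>j\<in>I. p j (u j)) * (\<Prod>j\<in>J. p j (w j))"
proof -
  let ?z = "\<lambda>j. if j \<in> I then u j else w j"
  have "cyl A I u \<inter> cyl A J w = cyl A (I \<union> J) ?z"
    using assms(3) by (auto simp: cyl_def)
  then have "measure M (cyl A I u \<inter> cyl A J w) = (\<Prod>j\<in>I \<union> J. p j (?z j))"
    using assms by (auto intro!: measure_cyl)
  also have "\<dots> = (\<Prod>j\<in>I. p j (?z j)) * (\<Prod>j\<in>J. p j (?z j))"
    using assms by (simp add: prod.union_disjoint)
  also have "(\<Prod>j\<in>J. p j (?z j)) = (\<Prod>j\<in>J. p j (w j))"
    using assms(3) by (intro prod.cong) auto
  finally show ?thesis by simp
qed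

text \<open>Since \<open>A\<close> is countable, every finite-dimensional rectangle is a countable
  disjoint union of cylinders over \<open>I \<union> J\<close>, and rectangles determine a finite
  measure. Only index sets containing \<open>J\<close> are tested, so a density depending on the
  coordinates in \<open>J\<close> is constant on each tested cylinder.\<close>

lemma measure_eqI_cyl:
  assumes P: "sets P = sets M" and Q: "sets Q = sets M" and "finite_measure P"
    and J: "finite J"
    and eq: "\<And>I w. finite I \<Longrightarrow> J \<subseteq> I \<Longrightarrow> w \<in> PiE I (\<lambda>_. A) \<Longrightarrow>
      emeasure P (cyl A I w) = emeasure Q (cyl A I w)"
  shows "P = Q"
proof (rule measure_eqI_PiM_infinite[where M=\<rho> and I=UNIV])
  show "sets P = sets (Pi\<^sub>M UNIV \<rho>)" "sets Q = sets (Pi\<^sub>M UNIV \<rho>)"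
    using P Q by (simp_all add: bernoulli_space_def)
  show "finite_measure P" by fact
  fix X :: "int \<Rightarrow> 'a set" and I :: "int set" assume I: "finite I"
    and X: "\<And>i. i \<in> I \<Longrightarrow> X i \<in> sets (\<rho> i)"
  let ?Y = "\<lambda>j. if j \<in> I then X j else A"
  have XA: "X i \<subseteq> A" if "i \<in> I" for i using X[OF that] by simp
  have "prod_emb UNIV \<rho> I (Pi\<^sub>E I X) = box A (I \<union> J) ?Y"
    using XA by (auto simp: prod_emb_def box_def PiE_def Pi_def)
  also have "\<dots> = (\<Union>w\<in>PiE (I \<union> J) (\<lambda>j. ?Y j \<inter> A). cyl A (I \<union> J) w)"
    by (rule box_eq_UN_cyl)
  finally have *: "prod_emb UNIV \<rho> I (Pi\<^sub>E I X) = \<dots>" .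
  have ct: "countable (PiE (I \<union> J) (\<lambda>j. ?Y j \<inter> A))"
    using I J countable_A by (intro countable_PiE) auto
  show "emeasure P (prod_emb UNIV \<rho> I (Pi\<^sub>E I X)) = emeasure Q (prod_emb UNIV \<rho> I (Pi\<^sub>E I X))"
    unfolding *
    apply (subst emeasure_UN_countable)
    subgoal using P by auto
    subgoal by (rule ct)
    subgoal by (rule disjoint_cyl)
    apply (subst emeasure_UN_countable)
    subgoal using Q by auto
    subgoal by (rule ct)
    subgoal by (rule disjoint_cyl)
    subgoal
    proof (intro nn_integral_cong eq)
      fix w assume "w \<in> space (count_space (PiE (I \<union> J) (\<lambda>j. ?Y j \<inter> A)))"
      then show "w \<in> PiE (I \<union> J) (\<lambda>_. A)" by auto
    qed (use I J in auto)
    done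
qed

end

section \<open>Comparison of two product measures on one alphabet\<close>

locale bernoulli_pair = bernoulli A \<rho> + N: bernoulli A \<rho>' for A :: "'a set" and \<rho> \<rho>' +
  assumes pos: "\<And>j a. a \<in> A \<Longrightarrow> measure (\<rho> j) {a} > 0"
    and pos': "\<And>j a. a \<in> A \<Longrightarrow> measure (\<rho>' j) {a} > 0"
begin

abbreviation "p' j a \<equiv> measure (\<rho>' j) {a}"

text \<open>A condition on points, not on marginals: off \<open>J\<close> the letters actually seen
  have the same mass under both families, although the laws may differ at every coordinate.\<close>

definition "agree J = box A (- J) (\<lambda>j. {a. p' j a = p j a})"

lemma measurable_agree [measurable]: "agree J \<in> sets M" "agree J \<in> sets N.M"
  by (auto simp: agree_def)

lemma sets_eq: "sets N.M = sets M"
  by (simp add: sets_M N.sets_M)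

text \<open>If \<open>w\<close> itself violates agreement on \<open>I - J\<close>, both sides
  vanish. Otherwise the set is a decreasing limit of finite-dimensional boxes, on which both
  measures factor and only the factors in \<open>J\<close> differ.\<close>

lemma measure_agree_cyl:
  assumes I: "finite I" and JI: "J \<subseteq> I" and w: "w \<in> PiE I (\<lambda>_. A)"
  shows "measure N.M (cyl A I w \<inter> agree J) =
    (\<Prod>j\<in>J. p' j (w j) / p j (w j)) * measure M (cyl A I w \<inter> agree J)"
proof (cases "\<forall>j\<in>I - J. p' j (w j) = p j (w j)")
  case False
  then obtain j where "j \<in> I" "j \<notin> J" "p' j (w j) \<noteq> p j (w j)" by auto
  moreover have "p' j (w j) = p j (w j)" if "x \<in> cyl A I w \<inter> agree J" for x
  proof -
    have "x j = w j" using that \<open>j \<in> I\<close> by (simp add: cyl_def)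
    moreover have "p' j (x j) = p j (x j)" using that \<open>j \<notin> J\<close> by (simp add: agree_def box_def)
    ultimately show ?thesis by simp
  qed
  ultimately have "cyl A I w \<inter> agree J = {}" by blast
  then show ?thesis by simp
next
  case True
  have wA: "w j \<in> A" if "j \<in> I" for j using w that by auto
  \<comment> \<open>\<open>Y\<close> fixes the letter of \<open>w\<close> on \<open>I\<close> and
    allows all letters of equal mass elsewhere; \<open>Z n\<close> imposes this on a finite window
    only, where the product formula applies.\<close>
  define Y where "Y j = (if j \<in> I then {w j} else {a\<in>A. p' j a = p j a})" for j
  define Z where "Z n = box A (I \<union> {- int n..int n}) Y" for n :: nat
  have Y: "Y j \<subseteq> A" for j using wA by (auto simp: Y_def)
  have eqY: "measure (\<rho>' j) (Y j) = measure (\<rho> j) (Y j)" if "j \<notin> J" for j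
  proof -
    have eq: "measure (\<rho>' j) {a} = measure (\<rho> j) {a}" if "a \<in> Y j" for a
      using True that \<open>j \<notin> J\<close> by (auto simp: Y_def split: if_splits)
    have c: "countable (Y j)" using Y countable_A by (rule countable_subset)
    have "emeasure (\<rho>' j) (Y j) = (\<integral>\<^sup>+a. emeasure (\<rho>' j) {a} \<partial>count_space (Y j))"
      using c Y by (intro emeasure_countable_singleton) auto
    also have "\<dots> = (\<integral>\<^sup>+a. emeasure (\<rho> j) {a} \<partial>count_space (Y j))"
      by (intro nn_integral_cong) (simp add: PP.M.emeasure_eq_measure N.PP.M.emeasure_eq_measure eq)
    also have "\<dots> = emeasure (\<rho> j) (Y j)"
      using c Y by (intro emeasure_countable_singleton[symmetric]) auto
    finally show ?thesis by (simp add: measure_def)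
  qed
  have Zeq: "measure N.M (Z n) = (\<Prod>j\<in>J. p' j (w j) / p j (w j)) * measure M (Z n)" for n
  proof -
    let ?K = "I \<union> {- int n..int n}"
    have K: "finite ?K" "J \<subseteq> ?K" using I JI by auto
    have "measure N.M (Z n) = (\<Prod>j\<in>J. measure (\<rho>' j) (Y j)) * (\<Prod>j\<in>?K-J. measure (\<rho>' j) (Y j))"
      unfolding Z_def using K Y by (simp add: N.measure_box prod.subset_diff mult.commute)
    also have "(\<Prod>j\<in>?K-J. measure (\<rho>' j) (Y j)) = (\<Prod>j\<in>?K-J. measure (\<rho> j) (Y j))"
      by (intro prod.cong) (auto simp: eqY)
    also have "(\<Prod>j\<in>J. measure (\<rho>' j) (Y j)) = (\<Prod>j\<in>J. (p' j (w j) / p j (w j)) * measure (\<rho> j) (Y j))"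
    proof (intro prod.cong refl)
      fix j assume "j \<in> J"
      then have "j \<in> I" using JI by auto
      then show "measure (\<rho>' j) (Y j) = p' j (w j) / p j (w j) * measure (\<rho> j) (Y j)"
        using pos[OF wA[of j], of j] by (simp add: Y_def)
    qed
    also have "\<dots> * (\<Prod>j\<in>?K-J. measure (\<rho> j) (Y j)) =
       (\<Prod>j\<in>J. p' j (w j) / p j (w j)) * ((\<Prod>j\<in>J. measure (\<rho> j) (Y j)) * (\<Prod>j\<in>?K-J. measure (\<rho> j) (Y j)))"
      by (simp only: prod.distrib mult.assoc)
    also have "(\<Prod>j\<in>J. measure (\<rho> j) (Y j)) * (\<Prod>j\<in>?K-J. measure (\<rho> j) (Y j)) = measure M (Z n)"
      unfolding Z_def using K Y by (simp add: measure_box prod.subset_diff mult.commute)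
    finally show ?thesis .
  qed
  have dec: "decseq Z"
    by (intro decseq_SucI) (auto simp: Z_def box_def)
  have int: "(\<Inter>n. Z n) = cyl A I w \<inter> agree J"
  proof (intro equalityI subsetI)
    fix x assume x: "x \<in> (\<Inter>n. Z n)"
    have xA: "x j \<in> A" for j using x by (auto simp: Z_def box_def)
    have xY: "x j \<in> Y j" for j
    proof -
      have "x \<in> Z (nat \<bar>j\<bar>)" using x by blast
      moreover have "j \<in> I \<union> {- int (nat \<bar>j\<bar>)..int (nat \<bar>j\<bar>)}" by auto
      ultimately show ?thesis unfolding Z_def box_def by blast
    qed
    have "p' j (x j) = p j (x j)" if "j \<notin> J" for j
      using xY[of j] True that by (auto simp: Y_def split: if_splits)
    moreover have "x j = w j" if "j \<in> I" for j using xY[of j] that by (simp add: Y_def)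
    ultimately show "x \<in> cyl A I w \<inter> agree J"
      using xA by (auto simp: cyl_def agree_def box_def)
  next
    fix x assume "x \<in> cyl A I w \<inter> agree J"
    then show "x \<in> (\<Inter>n. Z n)"
      using JI by (auto simp: Z_def cyl_def agree_def box_def Y_def)
  qed
  have "(\<lambda>n. measure M (Z n)) \<longlonglongrightarrow> measure M (\<Inter>n. Z n)"
    by (rule MM.finite_Lim_measure_decseq[OF _ dec]) (auto simp: Z_def)
  then have 1: "(\<lambda>n. measure N.M (Z n)) \<longlonglongrightarrow>
      (\<Prod>j\<in>J. p' j (w j) / p j (w j)) * measure M (\<Inter>n. Z n)"
    unfolding Zeq by (rule tendsto_mult_left)
  have "(\<lambda>n. measure N.M (Z n)) \<longlonglongrightarrow> measure N.M (\<Inter>n. Z n)"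
    by (rule N.MM.finite_Lim_measure_decseq[OF _ dec]) (auto simp: Z_def)
  from LIMSEQ_unique[OF this 1] show ?thesis unfolding int .
qed

abbreviation "ratio J x \<equiv> (\<Prod>j\<in>J. p' j (x j) / p j (x j))"

lemma measurable_ratio [measurable]: "ratio J \<in> borel_measurable M"
proof (intro borel_measurable_prod)
  fix j
  have "(\<lambda>a. p' j a / p j a) \<in> borel_measurable (count_space A)" by simp
  from measurable_compose[OF measurable_coord this]
  show "(\<lambda>x. p' j (x j) / p j (x j)) \<in> borel_measurable M" .
qed

text \<open>As functions of \<open>E\<close>, both sides are measures; they are compared on
  cylinders over sets containing \<open>J\<close>, where \<open>ratio J\<close> is constant.\<close>

lemma emeasure_agree:
  assumes J: "finite J" and E: "E \<in> sets M"
  shows "emeasure N.M (E \<inter> agree J) = (\<integral>\<^sup>+x. ennreal (ratio J x) * indicator (E \<inter> agree J) x \<partial>M)"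
proof -
  let ?P = "density N.M (indicator (agree J))"
  let ?Q = "density M (\<lambda>x. ennreal (ratio J x) * indicator (agree J) x)"
  have [measurable]: "E \<in> sets N.M" using E sets_eq by simp
  have P: "emeasure ?P X = emeasure N.M (X \<inter> agree J)" if "X \<in> sets M" for X
    using that sets_eq
    by (subst emeasure_density) (auto simp: indicator_inter_arith[symmetric] Int_commute)
  have Q: "emeasure ?Q X = (\<integral>\<^sup>+x. ennreal (ratio J x) * indicator (X \<inter> agree J) x \<partial>M)" if "X \<in> sets M" for X
    using that
    by (subst emeasure_density) (auto simp: indicator_inter_arith mult_ac intro!: nn_integral_cong)
  have "?P = ?Q"
  proof (rule measure_eqI_cyl[where J=J])
    show "sets ?P = sets M" "sets ?Q = sets M" by (simp_all add: sets_eq)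
    show "finite J" by fact
    show "finite_measure ?P"
    proof
      have "emeasure ?P (space ?P) \<le> 1"
        using P[of "space M"] N.MM.emeasure_le_1 sets_eq_imp_space_eq[OF sets_eq] by simp
      then show "emeasure ?P (space ?P) \<noteq> \<infinity>" by (auto simp: top_unique)
    qed
    fix I w assume I: "finite I" "J \<subseteq> I" and w: "w \<in> PiE I (\<lambda>_. A)"
    have "emeasure ?Q (cyl A I w) = (\<integral>\<^sup>+x. ennreal (ratio J w) * indicator (cyl A I w \<inter> agree J) x \<partial>M)"
      unfolding Q[OF measurable_cyl]
    proof (intro nn_integral_cong)
      fix x show "ennreal (ratio J x) * indicator (cyl A I w \<inter> agree J) x =
        ennreal (ratio J w) * indicator (cyl A I w \<inter> agree J) x"
      proof (cases "x \<in> cyl A I w")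
        case True
        then have "x j = w j" if "j \<in> J" for j using that I by (auto simp: cyl_def)
        then have "ratio J x = ratio J w" by (intro prod.cong) auto
        then show ?thesis by simp
      qed auto
    qed
    also have "\<dots> = ennreal (ratio J w) * emeasure M (cyl A I w \<inter> agree J)"
      by (subst nn_integral_cmult) auto
    also have "\<dots> = emeasure N.M (cyl A I w \<inter> agree J)"
      unfolding MM.emeasure_eq_measure N.MM.emeasure_eq_measure
        measure_agree_cyl[OF I w]
      by (simp add: ennreal_mult' prod_nonneg)
    finally show "emeasure ?P (cyl A I w) = emeasure ?Q (cyl A I w)"
      by (simp add: P measurable_cyl)
  qed
  then show ?thesis using P[OF E] Q[OF E] by simp
qed

end

text \<open>A concrete substitute for Kakutani's criterion: for both measures, almost every point
  meets differing masses only inside some finite \<open>J k\<close>.\<close>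

locale bernoulli_equiv = bernoulli_pair +
  fixes J :: "nat \<Rightarrow> int set"
  assumes fin_J: "\<And>k. finite (J k)"
    and AE_agree: "AE x in bernoulli_space \<rho>. \<exists>k. x \<in> agree (J k)"
    and AE_agree': "AE x in bernoulli_space \<rho>'. \<exists>k. x \<in> agree (J k)"
begin

text \<open>Cut \<open>E\<close> along the sets \<open>agree (J k)\<close>, which cover almost
  everything for both measures. On each piece the density is a finite product of positive
  ratios.\<close>

lemma emeasure_zero_iff:
  assumes E: "E \<in> sets M"
  shows "emeasure N.M E = 0 \<longleftrightarrow> emeasure M E = 0"
proof -
  have E': "E \<in> sets N.M" using E sets_eq by simp
  have red: "emeasure N.M E = 0 \<longleftrightarrow> (\<forall>k. emeasure N.M (E \<inter> agree (J k)) = 0)"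
  proof
    assume "emeasure N.M E = 0"
    then show "\<forall>k. emeasure N.M (E \<inter> agree (J k)) = 0"
      using E' by (metis Int_lower1 emeasure_eq_0)
  next
    assume *: "\<forall>k. emeasure N.M (E \<inter> agree (J k)) = 0"
    have "emeasure N.M (\<Union>k. E \<inter> agree (J k)) = 0"
      using * E' by (intro emeasure_UN_eq_0) auto
    moreover have "emeasure N.M E = emeasure N.M (\<Union>k. E \<inter> agree (J k))"
      using AE_agree' E' by (intro emeasure_eq_AE) (auto elim: eventually_mono)
    ultimately show "emeasure N.M E = 0" by simp
  qed
  have red': "emeasure M E = 0 \<longleftrightarrow> (\<forall>k. emeasure M (E \<inter> agree (J k)) = 0)"
  proof
    assume "emeasure M E = 0"
    then show "\<forall>k. emeasure M (E \<inter> agree (J k)) = 0"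
      using E by (metis Int_lower1 emeasure_eq_0)
  next
    assume *: "\<forall>k. emeasure M (E \<inter> agree (J k)) = 0"
    have "emeasure M (\<Union>k. E \<inter> agree (J k)) = 0"
      using * E by (intro emeasure_UN_eq_0) auto
    moreover have "emeasure M E = emeasure M (\<Union>k. E \<inter> agree (J k))"
      using AE_agree E by (intro emeasure_eq_AE) (auto elim: eventually_mono)
    ultimately show "emeasure M E = 0" by simp
  qed
  have "emeasure N.M (E \<inter> agree (J k)) = 0 \<longleftrightarrow> emeasure M (E \<inter> agree (J k)) = 0" for k
  proof -
    have "emeasure N.M (E \<inter> agree (J k)) = 0 \<longleftrightarrow>
       (AE x in M. ennreal (ratio (J k) x) * indicator (E \<inter> agree (J k)) x = 0)"
      unfolding emeasure_agree[OF fin_J E] using E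
      by (subst nn_integral_0_iff_AE) auto
    also have "\<dots> \<longleftrightarrow> (AE x in M. x \<notin> E \<inter> agree (J k))"
    proof (intro AE_cong)
      fix x assume "x \<in> space M"
      then have "ratio (J k) x > 0"
        using pos pos' by (intro prod_pos) (auto simp: space_M)
      then show "(ennreal (ratio (J k) x) * indicator (E \<inter> agree (J k)) x = 0) = (x \<notin> E \<inter> agree (J k))"
        by (auto simp: indicator_def)
    qed
    also have "\<dots> \<longleftrightarrow> emeasure M (E \<inter> agree (J k)) = 0"
      using E AE_iff_null_sets[of "E \<inter> agree (J k)" M] by (auto simp: null_sets_def)
    finally show ?thesis .
  qed
  then show ?thesis using red red' by simp
qed

lemma null_sets_eq: "null_sets N.M = null_sets M"
  using emeasure_zero_iff sets_eq by (auto simp: null_sets_def)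

text \<open>Uniqueness of densities, both functions being cut off to \<open>agree I\<close>. The
  finite set \<open>I\<close> is arbitrary; the sets \<open>J k\<close> enter through absolute
  continuity.\<close>

lemma AE_RN_deriv:
  assumes "finite I"
  shows "AE x in M. x \<in> agree I \<longrightarrow> enn2real (RN_deriv M N.M x) = ratio I x"
proof -
  have ac: "absolutely_continuous M N.M"
    by (simp add: absolutely_continuous_def null_sets_eq)
  let ?f = "\<lambda>x. RN_deriv M N.M x * indicator (agree I) x"
  let ?g = "\<lambda>x. ennreal (ratio I x) * indicator (agree I) x"
  have "AE x in M. ?f x = ?g x"
  proof (rule MM.density_unique)
    show "density M ?f = density M ?g"
    proof (rule measure_eqI)
      fix X assume "X \<in> sets (density M ?f)"
      then have X: "X \<in> sets M" by simp
      have d: "density M (RN_deriv M N.M) = N.M"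
        using MM.density_RN_deriv[OF ac sets_eq] .
      have "emeasure (density M ?f) X = (\<integral>\<^sup>+x. RN_deriv M N.M x * indicator (X \<inter> agree I) x \<partial>M)"
        using X by (subst emeasure_density) (auto simp: indicator_inter_arith mult_ac intro!: nn_integral_cong)
      also have "\<dots> = emeasure (density M (RN_deriv M N.M)) (X \<inter> agree I)"
        using X by (subst emeasure_density) auto
      also have "\<dots> = (\<integral>\<^sup>+x. ennreal (ratio I x) * indicator (X \<inter> agree I) x \<partial>M)"
        unfolding d using emeasure_agree[OF assms X] .
      also have "\<dots> = emeasure (density M ?g) X"
        using X by (subst emeasure_density) (auto simp: indicator_inter_arith mult_ac intro!: nn_integral_cong)
      finally show "emeasure (density M ?f) X = emeasure (density M ?g) X" .
    qed simp
  qed measurable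
  then show ?thesis
  proof eventually_elim
    case (elim x)
    show ?case
    proof
      assume "x \<in> agree I"
      then have "RN_deriv M N.M x = ennreal (ratio I x)" using elim by simp
      then show "enn2real (RN_deriv M N.M x) = ratio I x" by (simp add: prod_nonneg)
    qed
  qed
qed

end

section \<open>Shifts and approximation by cylinder sets\<close>

text \<open>
  With \<open>N\<close> the number of \<open>i \<in> S\<close> such that \<open>x \<in> X i\<close> and \<open>t = card S * P\<close>, integrate the inequality
  \<open>N \<le> N\<^sup>2 / (20 t) + 5 t\<close> over \<open>D\<close>.
\<close>

lemma (in finite_measure) sum_measure_Int_le:
  fixes S :: "'i set" and c P :: real
  assumes S: "finite S" "S \<noteq> {}" and X [measurable]: "\<And>i. i \<in> S \<Longrightarrow> X i \<in> sets M"
    and W [measurable]: "W \<in> sets M" and D [measurable]: "D \<in> sets M" and DW: "D \<subseteq> W"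
    and one: "\<And>i. i \<in> S \<Longrightarrow> measure M (W \<inter> X i) = c * P"
    and two: "\<And>i j. i \<in> S \<Longrightarrow> j \<in> S \<Longrightarrow> i \<noteq> j \<Longrightarrow> measure M (W \<inter> X i \<inter> X j) = c * P\<^sup>2"
    and P: "P > 0" "c \<ge> 0" and large: "1 \<le> card S * P" and small: "measure M D \<le> c / 50"
  shows "(\<Sum>i\<in>S. measure M (D \<inter> X i)) \<le> card S * (c * P) / 5"
proof -
  define t where "t = card S * P"
  have t: "t \<ge> 1" using large by (simp add: t_def)
  let ?N = "\<lambda>x. \<Sum>i\<in>S. indicator (X i) x :: real"
  let ?L = "\<lambda>x. \<Sum>i\<in>S. indicator (D \<inter> X i) x :: real"
  let ?R = "\<lambda>x. (1 / (20 * t)) * (\<Sum>i\<in>S. \<Sum>j\<in>S. indicator (W \<inter> X i \<inter> X j) x) + (5 * t) * indicator D x :: real"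
  have le: "?L x \<le> ?R x" for x
  proof (cases "x \<in> D")
    case True
    \<comment> \<open>The inequality is a completed square centred at \<open>10 * t\<close>.\<close>
    have "(1 / (20 * t)) * (?N x)\<^sup>2 + 5 * t - ?N x = (1 / (20 * t)) * (?N x - 10 * t)\<^sup>2"
      using t by (simp add: field_simps power2_eq_square)
    also have "\<dots> \<ge> 0" using t by simp
    finally have "?N x \<le> (1 / (20 * t)) * (?N x)\<^sup>2 + 5 * t" by simp
    moreover have "(\<Sum>i\<in>S. \<Sum>j\<in>S. indicator (W \<inter> X i \<inter> X j) x) = (?N x)\<^sup>2"
      using True DW by (auto simp: power2_eq_square sum_product indicator_inter_arith)
    moreover have "?L x = ?N x" using True by (simp add: indicator_inter_arith)
    ultimately show ?thesis using True by simp
  next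
    case False
    then show ?thesis using t by (auto intro!: sum_nonneg divide_nonneg_nonneg)
  qed
  have "(\<Sum>i\<in>S. measure M (D \<inter> X i)) = (\<integral>x. ?L x \<partial>M)"
    by (subst Bochner_Integration.integral_sum) (auto simp: integrable_indicator_iff emeasure_eq_measure)
  also have "\<dots> \<le> (\<integral>x. ?R x \<partial>M)"
    using le by (intro integral_mono) (auto intro!: Bochner_Integration.integrable_add
      Bochner_Integration.integrable_sum integrable_mult_right simp: integrable_indicator_iff emeasure_eq_measure)
  also have "\<dots> = (1 / (20 * t)) * (\<Sum>i\<in>S. \<Sum>j\<in>S. measure M (W \<inter> X i \<inter> X j)) + 5 * t * measure M D"
    apply (subst Bochner_Integration.integral_add)
    subgoal by (auto intro!: integrable_mult_right Bochner_Integration.integrable_sum simp: integrable_indicator_iff emeasure_eq_measure)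
    subgoal by (auto simp: integrable_indicator_iff emeasure_eq_measure)
    apply (simp add: Bochner_Integration.integral_sum integrable_indicator_iff emeasure_eq_measure)
    done
  \<comment> \<open>The diagonal terms are single events of mass \<open>c * P\<close>. They add
    \<open>c * t\<close> to the contribution \<open>c * t\<^sup>2\<close> of independent pairs, and
    \<open>t \<ge> 1\<close> absorbs it.\<close>
  also have "(\<Sum>i\<in>S. \<Sum>j\<in>S. measure M (W \<inter> X i \<inter> X j)) \<le> (\<Sum>i\<in>S. \<Sum>j\<in>S. c * P\<^sup>2 + (if i = j then c * P else 0))"
    using one two P by (intro sum_mono) auto
  also have "\<dots> = c * t\<^sup>2 + c * t"
    using S by (simp add: sum.distrib t_def power2_eq_square algebra_simps)
  also have "\<dots> \<le> 2 * c * t\<^sup>2"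
    using mult_left_mono[OF t, of "c * t"] t P by (simp add: power2_eq_square algebra_simps)
  \<comment> \<open>Each of the two summands is at most \<open>c * t / 10\<close>.\<close>
  also have "1 / (20 * t) * (2 * c * t\<^sup>2) + 5 * t * measure M D \<le> c * t / 10 + 5 * t * (c / 50)"
    using t small by (intro add_mono mult_left_mono) (auto simp: field_simps power2_eq_square)
  also have "\<dots> = card S * (c * P) / 5" by (simp add: t_def)
  finally show ?thesis using t by (simp add: divide_right_mono mult_left_mono)
qed

section \<open>Integer shifts and their effect on the product measure\<close>

definition shift :: "int \<Rightarrow> (int \<Rightarrow> 'a) \<Rightarrow> int \<Rightarrow> 'a" where
  "shift n x = (\<lambda>i. x (i + n))"

lemma shift_0 [simp]: "shift 0 x = x"
  and shift_shift [simp]: "shift n (shift k x) = shift (n + k) x"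
  by (auto simp: shift_def add_ac)

definition cylset :: "'a set \<Rightarrow> int set \<Rightarrow> (int \<Rightarrow> 'a) set \<Rightarrow> (int \<Rightarrow> 'a) set" where
  "cylset A J V = {x. (\<forall>j. x j \<in> A) \<and> restrict x J \<in> V}"

lemma cylset_eq_UN_cyl: "cylset A J V = (\<Union>v\<in>V \<inter> PiE J (\<lambda>_. A). cyl A J v)"
proof (intro equalityI subsetI)
  fix x assume "x \<in> cylset A J V"
  then have "restrict x J \<in> V \<inter> PiE J (\<lambda>_. A)" "x \<in> cyl A J (restrict x J)"
    by (auto simp: cylset_def cyl_def)
  then show "x \<in> (\<Union>v\<in>V \<inter> PiE J (\<lambda>_. A). cyl A J v)" by blast
next
  fix x assume "x \<in> (\<Union>v\<in>V \<inter> PiE J (\<lambda>_. A). cyl A J v)"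
  then obtain v where v: "v \<in> V" "v \<in> PiE J (\<lambda>_. A)" "x \<in> cyl A J v" by auto
  then have "restrict x J = v"
    by (intro PiE_ext[of _ J "\<lambda>_. A"]) (auto simp: cyl_def)
  then show "x \<in> cylset A J V" using v by (auto simp: cylset_def cyl_def)
qed

context bernoulli
begin

abbreviation "T \<equiv> int_iterate (space M) left_shift"

lemma shift_in_space [simp]: "shift n x \<in> space M \<longleftrightarrow> x \<in> space M"
proof -
  have "(\<forall>j. x (j + n) \<in> A) \<longleftrightarrow> (\<forall>j. x j \<in> A)"
    by (metis diff_add_cancel)
  then show ?thesis by (simp add: space_M shift_def)
qed

lemma funpow_shift:
  assumes "\<And>y. y \<in> space M \<Longrightarrow> f y = shift n y" "x \<in> space M"
  shows "(f ^^ k) x = shift (int k * n) x"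
  using assms(2) by (induction k) (simp_all add: assms(1) algebra_simps)

lemma T_eq:
  assumes x: "x \<in> space M"
  shows "T n x = shift n x"
proof -
  have l: "left_shift = shift 1" by (auto simp: left_shift_def shift_def fun_eq_iff)
  \<comment> \<open>Negative iterates are powers of \<open>inv_into\<close>, identified here with
    the right shift on \<open>space M\<close>.\<close>
  have inv: "inv_into (space M) left_shift y = shift (-1) y" if "y \<in> space M" for y
  proof (rule inv_into_f_eq)
    show "inj_on left_shift (space M)"
      by (rule inj_on_inverseI[of _ "shift (-1)"]) (simp add: l)
  qed (use that in \<open>simp_all add: l\<close>)
  show ?thesis
    using funpow_shift[OF _ x, of left_shift 1 "nat n"] funpow_shift[OF inv x, of "nat (-n)"]
    by (auto simp: int_iterate_def l)
qed

lemma measurable_shift [measurable]: "shift n \<in> measurable M M"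
proof -
  have "shift n \<in> measurable M (PiM UNIV (\<lambda>_. count_space A))"
    unfolding shift_def
    by (rule measurable_PiM_single') (auto simp: space_M)
  then show ?thesis by (subst measurable_cong_sets[OF refl sets_M])
qed

lemma measurable_action_T: "measurable_action M T"
proof -
  have "T n \<in> measurable M M" for n
    by (subst measurable_cong[of M "T n" "shift n"]) (simp_all add: T_eq measurable_shift)
  then show ?thesis
    unfolding measurable_action_def by (simp add: T_eq)
qed

lemma bernoulli_shifted: "bernoulli A (\<lambda>j. \<rho> (j - n))"
  using countable_A prob by unfold_locales

text \<open>Reindexing the coordinates of a product measure reindexes its marginals. The derivative
  of an iterate thus becomes the derivative between two product measures.\<close>

lemma translate_measure_T: "translate_measure M T n = bernoulli_space (\<lambda>j. \<rho> (j - n))"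
proof -
  have "translate_measure M T n = distr M M (shift (- n))"
    unfolding translate_measure_def by (intro distr_cong) (simp_all add: T_eq)
  also have "\<dots> = distr (PiM UNIV \<rho>) (\<Pi>\<^sub>M i\<in>UNIV. \<rho> (i - n)) (\<lambda>\<omega>. \<lambda>i\<in>UNIV. \<omega> (i - n))"
  proof (intro distr_cong)
    interpret s: bernoulli A "\<lambda>j. \<rho> (j - n)" by (rule bernoulli_shifted)
    show "sets M = sets (\<Pi>\<^sub>M i\<in>UNIV. \<rho> (i - n))"
      using s.sets_M sets_M by (simp add: bernoulli_space_def)
  qed (auto simp: bernoulli_space_def shift_def)
  also have "\<dots> = (\<Pi>\<^sub>M i\<in>UNIV. \<rho> (i - n))"
    by (rule distr_PiM_reindex) (auto intro: prob_space_rho simp: inj_on_def)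
  finally show ?thesis by (simp add: bernoulli_space_def)
qed

lemma emeasure_shifted:
  assumes "E \<in> sets M"
  shows "emeasure (bernoulli_space (\<lambda>j. \<rho> (j - n))) E = emeasure M (shift (- n) -` E \<inter> space M)"
proof -
  have "T (-n) -` E \<inter> space M = shift (- n) -` E \<inter> space M"
    using T_eq by auto
  then show ?thesis
    using emeasure_translate_measure[OF measurable_action_T assms, of n]
      measurable_action_image[OF measurable_action_T assms, of n]
    by (simp add: translate_measure_T)
qed

section \<open>Events depending on finitely many coordinates\<close>

lemma measurable_cylset [measurable, intro]:
  assumes "finite J" shows "cylset A J V \<in> sets M"
  unfolding cylset_eq_UN_cyl
  by (intro sets.countable_UN'' countable_subset[OF Int_lower2] countable_PiE assms countable_A) auto

text \<open>Independence of disjoint blocks of coordinates, summed over the countably many words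
  that make up \<open>cylset A J V\<close>.\<close>

lemma measure_cylset_Int_box:
  assumes "finite J" "finite I" "I \<inter> J = {}" and X: "\<And>j. j \<in> I \<Longrightarrow> X j \<subseteq> A"
  shows "measure M (cylset A J V \<inter> box A I X) = measure M (cylset A J V) * (\<Prod>j\<in>I. measure (\<rho> j) (X j))"
proof -
  let ?W = "V \<inter> PiE J (\<lambda>_. A)"
  let ?q = "\<Prod>j\<in>I. measure (\<rho> j) (X j)"
  have ct: "countable ?W"
    by (intro countable_subset[OF Int_lower2] countable_PiE assms countable_A)
  have dis: "disjoint_family_on (cyl A J) ?W"
    using disjoint_family_on_mono[OF Int_lower2 disjoint_cyl] .
  have cb: "measure M (cyl A J v \<inter> box A I X) = measure M (cyl A J v) * ?q" if "v \<in> ?W" for v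
  proof -
    let ?Y = "\<lambda>j. if j \<in> J then {v j} else X j"
    have vA: "v j \<in> A" if "j \<in> J" for j using \<open>v \<in> ?W\<close> that by auto
    have YA: "?Y j \<subseteq> A" if "j \<in> J \<union> I" for j using X[of j] vA[of j] that by auto
    have "cyl A J v \<inter> box A I X = box A (J \<union> I) ?Y"
      using assms(3) by (auto simp: cyl_def box_def)
    moreover have "measure M (box A (J \<union> I) ?Y) = (\<Prod>j\<in>J \<union> I. measure (\<rho> j) (?Y j))"
      by (rule measure_box[OF finite_UnI[OF assms(1,2)] YA])
    ultimately have "measure M (cyl A J v \<inter> box A I X) = (\<Prod>j\<in>J \<union> I. measure (\<rho> j) (?Y j))"
      by (simp only:)
    also have "\<dots> = (\<Prod>j\<in>J. measure (\<rho> j) (?Y j)) * (\<Prod>j\<in>I. measure (\<rho> j) (?Y j))"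
      using assms by (intro prod.union_disjoint) auto
    also have "(\<Prod>j\<in>I. measure (\<rho> j) (?Y j)) = ?q"
      using assms(3) by (intro prod.cong) auto
    also have "(\<Prod>j\<in>J. measure (\<rho> j) (?Y j)) = measure M (cyl A J v)"
      using assms vA by (simp add: measure_cyl)
    finally show ?thesis .
  qed
  have "emeasure M (cylset A J V \<inter> box A I X) = emeasure M (\<Union>v\<in>?W. cyl A J v \<inter> box A I X)"
    unfolding cylset_eq_UN_cyl by (rule arg_cong[where f="emeasure M"]) blast
  also have "\<dots> = (\<integral>\<^sup>+v. emeasure M (cyl A J v \<inter> box A I X) \<partial>count_space ?W)"
    using ct dis by (intro emeasure_UN_countable) (auto simp: disjoint_family_on_def)
  also have "\<dots> = (\<integral>\<^sup>+v. emeasure M (cyl A J v) * ennreal ?q \<partial>count_space ?W)"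
    by (intro nn_integral_cong) (simp add: MM.emeasure_eq_measure cb ennreal_mult'' prod_nonneg)
  also have "\<dots> = (\<integral>\<^sup>+v. emeasure M (cyl A J v) \<partial>count_space ?W) * ennreal ?q"
    by (rule nn_integral_multc) simp
  also have "(\<integral>\<^sup>+v. emeasure M (cyl A J v) \<partial>count_space ?W) = emeasure M (cylset A J V)"
    unfolding cylset_eq_UN_cyl using ct dis by (intro emeasure_UN_countable[symmetric]) auto
  finally have "ennreal (measure M (cylset A J V \<inter> box A I X)) = ennreal (measure M (cylset A J V) * ?q)"
    by (simp add: MM.emeasure_eq_measure ennreal_mult'' prod_nonneg)
  then show ?thesis by (simp add: prod_nonneg)
qed

text \<open>Induction over the generation of the product sigma-algebra: complements keep the
  symmetric difference, and a countable union is first truncated at cost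
  \<open>e / 2\<close>.\<close>

lemma approximation_by_cylset:
  assumes E: "E \<in> sets M" and e: "e > 0"
  shows "\<exists>J V. finite J \<and> measure M ((E - cylset A J V) \<union> (cylset A J V - E)) < e"
proof -
  let ?sp = "{x. \<forall>j::int. x j \<in> A}"
  let ?G = "{{f \<in> \<Pi>\<^sub>E i\<in>UNIV. space (count_space A). f i \<in> X} |i X. i \<in> (UNIV::int set) \<and> X \<in> sets (count_space A)}"
  have "sets M = sigma_sets (\<Pi>\<^sub>E i\<in>UNIV. space (count_space A)) ?G"
    unfolding sets_M by (rule sets_PiM_single)
  moreover have "(\<Pi>\<^sub>E i\<in>(UNIV::int set). space (count_space A)) = ?sp" by auto
  ultimately have "E \<in> sigma_sets ?sp ?G" using E by simp
  then show ?thesis using e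
  proof (induction arbitrary: e)
    case (Basic a)
    then obtain i X where a: "a = {f. (\<forall>j. f j \<in> A) \<and> f i \<in> X}" by auto
    have "a = cylset A {i} {v. v i \<in> X}" by (auto simp: a cylset_def)
    then show ?case using Basic by (intro exI[of _ "{i}"] exI[of _ "{v. v i \<in> X}"]) simp
  next
    case Empty
    have "cylset A {} {} = {}" by (simp add: cylset_def)
    then show ?case using Empty by (intro exI[of _ "{}"] exI[of _ "{}"]) simp
  next
    case (Compl a)
    then obtain J V where J: "finite J" and V: "measure M ((a - cylset A J V) \<union> (cylset A J V - a)) < e" by blast
    have "cylset A J (- V) = ?sp - cylset A J V" by (auto simp: cylset_def)
    moreover have "a \<subseteq> ?sp" using Compl.hyps
      by (rule sigma_sets_into_sp[rotated]) auto
    moreover have "cylset A J V \<subseteq> ?sp" by (auto simp: cylset_def)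
    ultimately have "(?sp - a - cylset A J (- V)) \<union> (cylset A J (- V) - (?sp - a)) =
      (a - cylset A J V) \<union> (cylset A J V - a)" by auto
    then show ?case using J V by (intro exI[of _ J] exI[of _ "- V"]) auto
  next
    case (Union a)
    have am: "a i \<in> sets M" for i
      using Union.hyps(1) \<open>sets M = _\<close> \<open>_ = ?sp\<close> by simp
    let ?U = "\<lambda>n. \<Union>i<n. a i"
    have "(\<lambda>n. measure M (?U n)) \<longlonglongrightarrow> measure M (\<Union>n. ?U n)"
      using am by (intro MM.finite_Lim_measure_incseq monoI UN_mono) auto
    moreover have UU: "(\<Union>n. ?U n) = (\<Union>i. a i)" by auto
    ultimately have "\<forall>\<^sub>F n in sequentially. measure M (\<Union>i. a i) - e / 2 < measure M (?U n)"
      using Union.prems by (intro order_tendstoD(1)[where a="measure M (\<Union>i. a i) - e/2"]) auto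
    then obtain n where n: "measure M (\<Union>i. a i) - e / 2 < measure M (?U n)"
      by (auto simp: eventually_sequentially)
    \<comment> \<open>The \<open>n\<close> retained sets share the other half of \<open>e\<close>;
      the denominator uses \<open>n + 1\<close> because \<open>n\<close> may be 0.\<close>
    have "e / (2 * (n + 1)) > 0" using Union.prems by simp
    with Union.IH have "\<forall>i. \<exists>J V. finite J \<and> measure M ((a i - cylset A J V) \<union> (cylset A J V - a i)) < e / (2 * (n + 1))"
      by blast
    then obtain J V where J: "\<And>i. finite (J i)"
      and V: "\<And>i. measure M ((a i - cylset A (J i) (V i)) \<union> (cylset A (J i) (V i) - a i)) < e / (2 * (n + 1))"
      by metis
    let ?J = "\<Union>i<n. J i"
    let ?V = "{v. \<exists>i<n. restrict v (J i) \<in> V i}"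
    let ?d = "\<lambda>i. (a i - cylset A (J i) (V i)) \<union> (cylset A (J i) (V i) - a i)"
    have r: "restrict (restrict x ?J) (J i) = restrict x (J i)" if "i < n" for x :: "int \<Rightarrow> 'a" and i
      using that by (auto simp: restrict_def fun_eq_iff)
    have c: "cylset A ?J ?V = (\<Union>i<n. cylset A (J i) (V i))"
      using r by (auto simp: cylset_def)
    have dm: "?d i \<in> sets M" for i using am J by auto
    have am': "(\<Union>i. a i) \<in> sets M" "?U n \<in> sets M" using am by auto
    have "measure M (((\<Union>i. a i) - cylset A ?J ?V) \<union> (cylset A ?J ?V - (\<Union>i. a i)))
      \<le> measure M (((\<Union>i. a i) - ?U n) \<union> (\<Union>i<n. ?d i))"
      using am' dm unfolding c by (intro MM.finite_measure_mono) (blast, auto)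
    also have "\<dots> \<le> measure M ((\<Union>i. a i) - ?U n) + measure M (\<Union>i<n. ?d i)"
      using am' dm by (intro measure_Un_le) auto
    also have "measure M ((\<Union>i. a i) - ?U n) = measure M (\<Union>i. a i) - measure M (?U n)"
      using am' by (intro MM.finite_measure_Diff) auto
    also have "measure M (\<Union>i<n. ?d i) \<le> (\<Sum>i<n. measure M (?d i))"
      using dm by (intro MM.finite_measure_subadditive_finite) auto
    also have "\<dots> \<le> (\<Sum>i<n. e / (2 * (n + 1)))"
      using V by (intro sum_mono less_imp_le)
    also have "\<dots> \<le> e / 2"
      using Union.prems by (simp add: field_simps)
    finally have "measure M (((\<Union>i. a i) - cylset A ?J ?V) \<union> (cylset A ?J ?V - (\<Union>i. a i))) < e"
      using n by linarith
    then show ?case using J by blast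
  qed
qed

end

section \<open>The family of measures\<close>

text \<open>Countable subadditivity; the geometric series gives \<open>8 / 7 * c\<close>, rounded
  up.\<close>

lemma (in finite_measure) measure_UN_le_geometric:
  assumes X: "\<And>t::nat. X t \<in> sets M" and le: "\<And>t. measure M (X t) \<le> c * (1 / 8) ^ t"
  shows "measure M (\<Union>t. X t) \<le> 2 * c"
proof -
  have s: "(\<lambda>t. c * (1 / 8) ^ t) sums (c * (1 / (1 - 1 / 8)))"
    by (intro sums_mult geometric_sums) simp
  have sm: "summable (\<lambda>t. measure M (X t))"
    using le by (intro summable_comparison_test[OF _ sums_summable[OF s]]) auto
  have c: "c \<ge> 0" using le[of 0] measure_nonneg[of M "X 0"] unfolding power_0 by linarith
  have "measure M (\<Union>t. X t) \<le> (\<Sum>t. measure M (X t))"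
    using X sm by (intro finite_measure_subadditive_countably) auto
  also have "\<dots> \<le> (\<Sum>t. c * (1 / 8) ^ t)"
    using le sm s by (intro suminf_le) (auto simp: sums_iff)
  also have "\<dots> = c * (1 / (1 - 1 / 8))" using s by (simp add: sums_iff)
  also have "\<dots> \<le> 2 * c" using c by simp
  finally show ?thesis .
qed

text \<open>
  The symbols are numbered: \<open>3 k + 1\<close>, \<open>3 k + 2\<close> and \<open>3 k + 3\<close> form the triple of the window \<open>B k\<close>, whose
  first two masses are exchanged at the coordinates in \<open>B k\<close>.
\<close>

definition swap_masses :: "(nat \<Rightarrow> int set) \<Rightarrow> int \<Rightarrow> nat \<Rightarrow> nat" where
  "swap_masses B j i = (case i of 0 \<Rightarrow> 0 | Suc t \<Rightarrow>
     if j \<in> B (t div 3) \<and> t mod 3 = 0 then Suc (Suc t)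
     else if j \<in> B (t div 3) \<and> t mod 3 = 1 then t else Suc t)"

lemma swap_masses_simps [simp]:
  "swap_masses B j 0 = 0"
  "swap_masses B j (Suc (3 * k)) = (if j \<in> B k then Suc (Suc (3 * k)) else Suc (3 * k))"
  "swap_masses B j (Suc (Suc (3 * k))) = (if j \<in> B k then Suc (3 * k) else Suc (Suc (3 * k)))"
  "swap_masses B j (Suc (Suc (Suc (3 * k)))) = Suc (Suc (Suc (3 * k)))"
proof -
  have "Suc (3 * k) div 3 = k" "Suc (3 * k) mod 3 = 1" "Suc (Suc (3 * k)) div 3 = k" "Suc (Suc (3 * k)) mod 3 = 2"
    by presburger+
  then show "swap_masses B j 0 = 0"
  "swap_masses B j (Suc (3 * k)) = (if j \<in> B k then Suc (Suc (3 * k)) else Suc (3 * k))"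
  "swap_masses B j (Suc (Suc (3 * k))) = (if j \<in> B k then Suc (3 * k) else Suc (Suc (3 * k)))"
  "swap_masses B j (Suc (Suc (Suc (3 * k)))) = Suc (Suc (Suc (3 * k)))"
    by (simp_all add: swap_masses_def)
qed

lemma symbol_cases:
  fixes i :: nat
  obtains (zero) "i = 0" | (a) k where "i = Suc (3 * k)" | (b) k where "i = Suc (Suc (3 * k))"
    | (c) k where "i = Suc (Suc (Suc (3 * k)))"
proof (cases i)
  case (Suc t)
  have "t = 3 * (t div 3) \<or> t = Suc (3 * (t div 3)) \<or> t = Suc (Suc (3 * (t div 3)))" by presburger
  then show ?thesis using Suc that by blast
qed (use that in blast)

text \<open>
  Assumption \<open>s\<close> makes the expected number of visits to any cell along \<open>s k\<close> independent times at least
  one, since \<open>(m k * lam ^ k) ^ d k\<close> bounds the mass of every cell of level \<open>k\<close> from below; \<open>small\<close> makes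
  all later windows negligible up to the time \<open>d k * s k\<close>.
\<close>

locale lacunary = bernoulli A \<rho> for A :: "'a set" and \<rho> +
  fixes idx :: "'a \<Rightarrow> nat" and lam :: real and v m :: "nat \<Rightarrow> real"
    and r N l d s :: "nat \<Rightarrow> nat" and B :: "nat \<Rightarrow> int set"
  assumes bij: "bij_betw idx A UNIV"
    and lam: "0 < lam" "lam < 1"
    and v_0: "1 / 2 \<le> v 0" and v_a: "\<And>k. v (Suc (3 * k)) = m k"
    and v_b: "\<And>k. v (Suc (Suc (3 * k))) = m k * lam ^ r k"
    and v_c: "\<And>k. v (Suc (Suc (Suc (3 * k)))) = m k"
    and m_pos: "\<And>k. 0 < m k" and m_0: "m 0 \<le> 1 / 2" and m_Suc: "\<And>k. m (Suc k) \<le> m k / 8"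
    and r_le: "\<And>k. r k \<le> k" and r_inf: "\<And>n K. \<exists>k\<ge>K. r k = n"
    and N_0: "1 \<le> N 0" and N_Suc: "\<And>k. N (Suc k) = N k + l k + d k * s k + 1"
    and d: "\<And>k. d k = 2 * (N k + l k) + 1"
    and l: "\<And>k. 1 \<le> m k * l k"
    and s: "\<And>k. 1 \<le> s k * (m k * lam ^ k) ^ d k"
    and small: "\<And>k. 50 * m (Suc k) * (d k * s k) \<le> ((m k * lam ^ k) ^ d k)\<^sup>2"
    and B: "\<And>k. B k = {int (N k)..<int (N k + l k)}"
    and mass: "\<And>j a. a \<in> A \<Longrightarrow> measure (\<rho> j) {a} = v (swap_masses B j (idx a))"
begin

text \<open>\<open>q k\<close> is the excluded right end of \<open>B k\<close>. The symmetric
  interval \<open>Q k\<close> has exactly \<open>d k\<close> points, and \<open>g k\<close> will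
  bound the mass of every cell on it from below.\<close>

definition "q k = int (N k + l k)"
definition "Q k = {- q k..q k}"
definition "g k = (m k * lam ^ k) ^ d k"

section \<open>Bounds on the masses of the symbols\<close>

lemma m_add: "m (k + t) \<le> m k * (1 / 8) ^ t"
proof (induction t)
  case (Suc t)
  then show ?case using m_Suc[of "k + t"] by simp
qed simp

lemma m_antimono: "k \<le> k' \<Longrightarrow> m k' \<le> m k"
proof -
  assume "k \<le> k'"
  then have "m k' \<le> m k * (1 / 8) ^ (k' - k)" using m_add[of k "k' - k"] by simp
  also have "\<dots> \<le> m k * 1" using m_pos[of k] by (intro mult_left_mono power_le_one) auto
  finally show ?thesis by simp
qed

lemma m_le_half: "m k \<le> 1 / 2"
  using m_antimono[of 0 k] m_0 by simp

lemma m_tendsto: "m \<longlonglongrightarrow> 0"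
proof (rule tendsto_sandwich[of "\<lambda>_. 0" m _ "\<lambda>k. (1/2) * (1/8)^k"])
  show "\<forall>\<^sub>F k in sequentially. m k \<le> 1 / 2 * (1 / 8) ^ k"
  proof (intro always_eventually allI)
    fix k
    have "m k \<le> m 0 * (1/8)^k" using m_add[of 0 k] by simp
    also have "\<dots> \<le> (1/2) * (1/8)^k" using m_0 by (intro mult_right_mono) auto
    finally show "m k \<le> 1 / 2 * (1 / 8) ^ k" .
  qed
  show "(\<lambda>k. 1 / 2 * (1 / 8 :: real) ^ k) \<longlonglongrightarrow> 0"
    by (intro tendsto_mult_right_zero LIMSEQ_realpow_zero) auto
qed (auto simp: m_pos less_imp_le)

lemma lam_pow: "0 < lam ^ k" "lam ^ k \<le> 1"
  using lam by (auto simp: power_le_one)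

text \<open>Among the triples up to level \<open>k\<close> the second symbols are the lightest, with
  factor \<open>lam ^ r k'\<close> and \<open>r k' \<le> k' \<le> k\<close>.\<close>

lemma v_ge: assumes "i \<le> 3 * k + 3" shows "m k * lam ^ k \<le> v i"
proof -
  have le: "m k * lam ^ k \<le> m k' * lam ^ t" if "k' \<le> k" "t \<le> k'" for k' t
    using that m_antimono[of k' k] m_pos[of k] lam
    by (intro mult_mono power_decreasing) (auto simp: less_imp_le)
  show ?thesis
  proof (cases i rule: symbol_cases)
    case zero
    have "m k * lam ^ k \<le> (1/2) * 1"
      using m_le_half[of k] lam_pow[of k] m_pos[of k] by (intro mult_mono) auto
    then show ?thesis using zero v_0 by simp
  next
    case (a k') then show ?thesis using assms le[of k' 0] by (simp add: v_a)
  next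
    case (b k') then show ?thesis using assms le[of k' "r k'"] r_le[of k'] by (simp add: v_b)
  next
    case (c k') then show ?thesis using assms le[of k' 0] by (simp add: v_c)
  qed
qed

lemma v_pos: "0 < v i"
proof -
  have "m i * lam ^ i \<le> v i" by (rule v_ge) simp
  moreover have "0 < m i * lam ^ i" using m_pos lam_pow by simp
  ultimately show ?thesis by linarith
qed

lemma swap_masses_le: "i \<le> 3 * k + 3 \<Longrightarrow> swap_masses B j i \<le> 3 * k + 3"
  by (cases i rule: symbol_cases) (auto, presburger)

lemma p_pos: "a \<in> A \<Longrightarrow> 0 < p j a"
  by (simp add: mass v_pos)

lemma p_ge: "a \<in> A \<Longrightarrow> idx a \<le> 3 * k + 3 \<Longrightarrow> m k * lam ^ k \<le> p j a"
  by (simp add: mass v_ge swap_masses_le)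

lemma p_eq_v: "a \<in> A \<Longrightarrow> (\<And>k. j \<notin> B k) \<Longrightarrow> p j a = v (idx a)"
  by (cases "idx a" rule: symbol_cases) (auto simp: mass)

text \<open>An exchange multiplies a mass by \<open>lam\<close> to the power plus or minus
  \<open>r k\<close>. Ratios of masses of one symbol at different coordinates are therefore integer
  powers of \<open>lam\<close>, which confines the ratio set.\<close>

lemma p_powi: assumes "a \<in> A" shows "\<exists>z. p j a = v (idx a) * lam powi z"
proof (cases "idx a" rule: symbol_cases)
  case zero
  then show ?thesis using assms by (intro exI[of _ 0]) (simp add: mass)
next
  case (a k)
  then show ?thesis using assms lam
    by (intro exI[of _ "if j \<in> B k then int (r k) else 0"]) (simp add: mass v_a v_b)
next
  case (b k)
  then show ?thesis using assms lam
    by (intro exI[of _ "if j \<in> B k then - int (r k) else 0"]) (simp add: mass v_a v_b power_int_minus)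
next
  case (c k)
  then show ?thesis using assms by (intro exI[of _ 0]) (simp add: mass)
qed

text \<open>The only symbols of level \<open>k\<close> whose mass can depend on the
  coordinate.\<close>

definition "pair k = {a \<in> A. idx a = Suc (3 * k) \<or> idx a = Suc (Suc (3 * k))}"

lemma pair_if_p_neq:
  assumes "a \<in> A" "p i a \<noteq> p j a"
  shows "\<exists>k. a \<in> pair k \<and> (i \<in> B k) \<noteq> (j \<in> B k)"
  using assms by (cases "idx a" rule: symbol_cases) (auto simp: mass pair_def split: if_splits)

lemma inj_idx: "a \<in> A \<Longrightarrow> a' \<in> A \<Longrightarrow> idx a = idx a' \<longleftrightarrow> a = a'"
  using bij by (auto simp: bij_betw_def inj_on_def)

definition "symbol i = inv_into A idx i"

lemma symbol: "symbol i \<in> A" "idx (symbol i) = i"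
proof -
  have i: "i \<in> idx ` A" using bij_betw_imp_surj_on[OF bij] by simp
  show "symbol i \<in> A" unfolding symbol_def by (rule inv_into_into[OF i])
  show "idx (symbol i) = i" unfolding symbol_def by (rule f_inv_into_f[OF i])
qed

lemma symbol_idx: "a \<in> A \<Longrightarrow> symbol (idx a) = a"
  using inj_idx[of "symbol (idx a)" a] symbol by simp

lemma measure_symbol: "measure (\<rho> j) {symbol i} = v (swap_masses B j i)"
  by (simp add: mass symbol)

lemma measure_pair: "measure (\<rho> j) (pair k) \<le> 2 * m k"
proof -
  have "pair k = {symbol (Suc (3 * k))} \<union> {symbol (Suc (Suc (3 * k)))}"
    using symbol by (auto simp: pair_def dest: symbol_idx)
  then have "measure (\<rho> j) (pair k) \<le> measure (\<rho> j) {symbol (Suc (3 * k))} + measure (\<rho> j) {symbol (Suc (Suc (3 * k)))}"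
    using symbol by (simp only:) (intro measure_Un_le, auto)
  also have "\<dots> = m k + m k * lam ^ r k" by (simp add: measure_symbol v_a v_b)
  also have "\<dots> \<le> m k + m k * 1" using m_pos[of k] lam_pow[of "r k"] by (intro add_left_mono mult_left_mono) auto
  finally show ?thesis by simp
qed

definition "triple k = {symbol (Suc (3 * k)), symbol (Suc (Suc (3 * k))), symbol (Suc (Suc (Suc (3 * k))))}"

lemma measure_triple: "measure (\<rho> j) (triple k) \<le> 3 * m k"
proof -
  have "triple k = {symbol (Suc (3 * k))} \<union> ({symbol (Suc (Suc (3 * k)))} \<union> {symbol (Suc (Suc (Suc (3 * k))))})"
    by (auto simp: triple_def)
  then have "measure (\<rho> j) (triple k) \<le> measure (\<rho> j) {symbol (Suc (3 * k))} + (measure (\<rho> j) {symbol (Suc (Suc (3 * k)))} + measure (\<rho> j) {symbol (Suc (Suc (Suc (3 * k))))})"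
    using symbol by (simp only:) (intro measure_Un_le[THEN order_trans] add_left_mono measure_Un_le, auto)
  also have "\<dots> = m k + (m k * lam ^ r k + m k)" by (simp add: measure_symbol v_a v_b v_c)
  also have "m k * lam ^ r k \<le> m k * 1" using m_pos[of k] lam_pow[of "r k"] by (intro mult_left_mono) auto
  finally show ?thesis by simp
qed

text \<open>These symbols lie in the triples beyond level \<open>K\<close>, whose masses decrease
  geometrically.\<close>

lemma measure_large_symbols: "measure (\<rho> j) {a \<in> A. 3 * K + 3 < idx a} \<le> 6 * m (Suc K)"
proof -
  have "{a \<in> A. 3 * K + 3 < idx a} \<subseteq> (\<Union>t. triple (Suc K + t))"
  proof
    fix a assume a: "a \<in> {a \<in> A. 3 * K + 3 < idx a}"
    have *: "a \<in> triple k \<Longrightarrow> Suc K \<le> k \<Longrightarrow> a \<in> (\<Union>t. triple (Suc K + t))" for k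
      by (intro UN_I[of "k - Suc K"]) auto
    have eq: "symbol (idx a) = a" using a by (simp add: symbol_idx)
    show "a \<in> (\<Union>t. triple (Suc K + t))"
    proof (cases "idx a" rule: symbol_cases)
      case (a k) then show ?thesis using eq \<open>a \<in> _\<close> by (intro *[of k]) (auto simp: triple_def)
    next
      case (b k) then show ?thesis using eq \<open>a \<in> _\<close> by (intro *[of k]) (auto simp: triple_def)
    next
      case (c k) then show ?thesis using eq \<open>a \<in> _\<close> by (intro *[of k]) (auto simp: triple_def)
    qed (use a in auto)
  qed
  then have "measure (\<rho> j) {a \<in> A. 3 * K + 3 < idx a} \<le> measure (\<rho> j) (\<Union>t. triple (Suc K + t))"
    using symbol by (intro PP.M.finite_measure_mono) (auto simp: triple_def)
  also have "\<dots> \<le> 2 * (3 * m (Suc K))"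
  proof (rule PP.M.measure_UN_le_geometric)
    fix t show "measure (\<rho> j) (triple (Suc K + t)) \<le> 3 * m (Suc K) * (1 / 8) ^ t"
      using measure_triple[of j "Suc K + t"] m_add[of "Suc K" t] by simp
  qed (use symbol in \<open>auto simp: triple_def\<close>)
  finally show ?thesis by simp
qed

text \<open>The complement of \<open>agree J\<close> for the marginals shifted by \<open>n\<close>,
  stated inside \<open>space M\<close> so that it can be measured under every shifted
  product.\<close>

definition "disagree n J = {x \<in> space M. \<exists>j\<in>- J. p (j - n) (x j) \<noteq> p j (x j)}"

lemma disagree_eq: "disagree n J = space M - box A (- J) (\<lambda>j. {a. p (j - n) a = p j a})"
  by (auto simp: disagree_def box_def space_M)

lemma measurable_disagree [measurable]: "disagree n J \<in> sets M"
  unfolding disagree_eq by auto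

text \<open>\<open>J\<close> absorbs every change due to the windows up to level \<open>K\<close>.
  In a later window the shift changes membership at no more than \<open>2 \<bar>n\<bar>\<close>
  coordinates, and a change is visible only if a symbol of \<open>pair k\<close> sits there. The
  bound on \<open>pair k\<close> holds at all coordinates, so the measure may be shifted by any
  \<open>c\<close>.\<close>

lemma measure_disagree:
  assumes J: "\<And>k j. k \<le> K \<Longrightarrow> j \<in> B k \<Longrightarrow> j \<in> J \<and> j + n \<in> J"
  shows "measure (bernoulli_space (\<lambda>j. \<rho> (j - c))) (disagree n J) \<le> 8 * real_of_int \<bar>n\<bar> * m (Suc K)"
proof -
  interpret s: bernoulli A "\<lambda>j. \<rho> (j - c)" by (rule bernoulli_shifted)
  define D where "D k = {j. (j \<in> B k) \<noteq> (j - n \<in> B k)}" for k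
  have D: "finite (D k)" "card (D k) \<le> 2 * nat \<bar>n\<bar>" for k
  proof -
    let ?a = "int (N k)" and ?b = "int (N k + l k)"
    let ?I = "\<lambda>c. {min c (c + n)..<max c (c + n)}"
    \<comment> \<open>An interval and its translate by \<open>n\<close> differ only within two
      intervals of length \<open>\<bar>n\<bar>\<close> at the endpoints.\<close>
    have sub: "D k \<subseteq> ?I ?a \<union> ?I ?b" by (auto simp: D_def B)
    then show "finite (D k)" by (rule finite_subset) simp
    have "card (D k) \<le> card (?I ?a \<union> ?I ?b)" using sub by (intro card_mono) auto
    also have "\<dots> \<le> card (?I ?a) + card (?I ?b)" by (rule card_Un_le)
    also have "\<dots> = 2 * nat \<bar>n\<bar>" by (auto simp: min_def max_def)
    finally show "card (D k) \<le> 2 * nat \<bar>n\<bar>" .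
  qed
  define Z where "Z k = (\<Union>j\<in>D k. box A {j} (\<lambda>_. pair k))" for k
  have Zm: "Z k \<in> sets s.M" for k
    unfolding Z_def using D by (intro sets.finite_UN) auto
  have "disagree n J \<subseteq> (\<Union>t. Z (Suc K + t))"
  proof
    fix x assume "x \<in> disagree n J"
    then obtain j where x: "\<And>j. x j \<in> A" "j \<notin> J" "p (j - n) (x j) \<noteq> p j (x j)"
      by (auto simp: disagree_def space_M)
    from pair_if_p_neq[OF x(1) x(3)] obtain k where k: "x j \<in> pair k" "(j - n \<in> B k) \<noteq> (j \<in> B k)" by blast
    have "K < k"
    proof (rule ccontr)
      assume "\<not> K < k"
      then have "k \<le> K" by simp
      from J[OF this, of j] J[OF this, of "j - n"] k x(2) show False by auto
    qed
    moreover have "x \<in> Z k" using x(1) k by (auto simp: Z_def D_def box_def)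
    ultimately show "x \<in> (\<Union>t. Z (Suc K + t))" by (intro UN_I[of "k - Suc K"]) auto
  qed
  then have "measure s.M (disagree n J) \<le> measure s.M (\<Union>t. Z (Suc K + t))"
    using Zm by (intro s.MM.finite_measure_mono) auto
  also have "\<dots> \<le> 2 * (4 * real_of_int \<bar>n\<bar> * m (Suc K))"
  proof (rule s.MM.measure_UN_le_geometric[OF Zm])
    fix t
    let ?k = "Suc K + t"
    have "measure s.M (Z ?k) \<le> (\<Sum>j\<in>D ?k. measure s.M (box A {j} (\<lambda>_. pair ?k)))"
      unfolding Z_def using D by (intro s.MM.finite_measure_subadditive_finite) auto
    also have "\<dots> \<le> (\<Sum>j\<in>D ?k. 2 * m ?k)"
    proof (intro sum_mono)
      fix j
      have "pair ?k \<subseteq> A" by (auto simp: pair_def)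
      then have "measure s.M (box A {j} (\<lambda>_. pair ?k)) = measure (\<rho> (j - c)) (pair ?k)"
        by (subst s.measure_box) auto
      then show "measure s.M (box A {j} (\<lambda>_. pair ?k)) \<le> 2 * m ?k" using measure_pair by simp
    qed
    also have "\<dots> = card (D ?k) * (2 * m ?k)" by simp
    also have "\<dots> \<le> (2 * real_of_int \<bar>n\<bar>) * (2 * (m (Suc K) * (1 / 8) ^ t))"
      using D[of ?k] m_add[of "Suc K" t] m_pos[of ?k] by (intro mult_mono) auto
    finally show "measure s.M (Z ?k) \<le> 4 * real_of_int \<bar>n\<bar> * m (Suc K) * (1 / 8) ^ t" by simp
  qed
  finally show ?thesis by simp
qed

section \<open>Positions of the windows and of the gaps between them\<close>

lemma N_pos: "1 \<le> N k"
  by (cases k) (use N_0 in \<open>auto simp: N_Suc\<close>)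

lemma q_pos: "0 < q k"
  using N_pos[of k] by (simp add: q_def)

text \<open>\<open>N_Suc\<close> reserves behind \<open>B k\<close> a gap longer than the longest
  time \<open>d k * s k\<close> used at level \<open>k\<close>.\<close>

lemma N_ge: "k < k' \<Longrightarrow> q k + int (d k * s k) < int (N k')"
proof (induction k' )
  case (Suc k')
  have "int (N k') \<le> int (N (Suc k'))" by (simp add: N_Suc)
  moreover have "q k + int (d k * s k) < int (N (Suc k))" by (simp add: N_Suc q_def)
  ultimately show ?case using Suc by (cases "k = k'") auto
qed simp

lemma q_less_N: "k < k' \<Longrightarrow> q k < int (N k')"
  using N_ge[of k k'] of_nat_0_le_iff[of "d k * s k", where ?'a=int] by linarith

lemma N_le_q: "int (N k) \<le> q k"
  by (simp add: q_def)

lemma q_mono: "k \<le> k' \<Longrightarrow> q k \<le> q k'"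
  using q_less_N[of k k'] N_le_q[of k'] by (cases "k = k'") auto

lemma q_ge: "int k \<le> q k"
proof (induction k)
  case (Suc k)
  then show ?case using q_less_N[of k "Suc k"] N_le_q[of "Suc k"] by simp
qed (use q_pos[of 0] in simp)

lemma B_pos: "j \<in> B k \<Longrightarrow> 0 < j"
  using N_pos[of k] by (simp add: B)

lemma B_less: "j \<in> B k \<Longrightarrow> j < q k"
  by (simp add: B q_def)

lemma B_subset_Q: "k \<le> k' \<Longrightarrow> B k \<subseteq> Q k'"
  using B_pos B_less q_mono[of k k'] by (fastforce simp: Q_def)

text \<open>All windows lie on the positive side, and none meets the gap behind
  \<open>B k\<close>.\<close>

lemma p_eq_v_gap:
  assumes "a \<in> A" "j \<le> 0 \<or> q k < j \<and> j \<le> q k + int (d k * s k)"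
  shows "p j a = v (idx a)"
proof (rule p_eq_v[OF assms(1)])
  fix k'
  show "j \<notin> B k'"
  proof
    assume j: "j \<in> B k'"
    show False
    proof (cases "k' \<le> k")
      case True
      then show False using B_pos[OF j] B_less[OF j] q_mono[OF True] assms(2) by auto
    next
      case False
      then have "int (N k') \<le> j" using j by (simp add: B)
      then show False using N_ge[of k k'] False assms(2) B_pos[OF j] by auto
    qed
  qed
qed

lemma pair_shifted: "bernoulli_pair A \<rho> (\<lambda>j. \<rho> (j - n))"
  by (intro_locales) (unfold_locales, auto intro: countable_A prob p_pos)

text \<open>Enlarging \<open>Q k\<close> by \<open>\<bar>n\<bar>\<close> on both sides captures the
  first windows and their translates. The exceptional set has measure at most
  \<open>8 \<bar>n\<bar> m (Suc k)\<close> for every \<open>k\<close>, hence is null.\<close>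

lemma equiv_shifted: "bernoulli_equiv A \<rho> (\<lambda>j. \<rho> (j - n)) (\<lambda>k. {- q k - \<bar>n\<bar>..q k + \<bar>n\<bar>})"
proof -
  interpret P: bernoulli_pair A \<rho> "\<lambda>j. \<rho> (j - n)" by (rule pair_shifted)
  let ?J = "\<lambda>k. {- q k - \<bar>n\<bar>..q k + \<bar>n\<bar>}"
  have ag: "P.agree J = space M - disagree n J" for J
    by (auto simp: P.agree_def disagree_eq box_def space_M)
  \<comment> \<open>The parameter \<open>c\<close> serves both required statements: 0 for the
    original measure and \<open>n\<close> for the shifted one.\<close>
  have main: "AE x in bernoulli_space (\<lambda>j. \<rho> (j - c)). \<exists>k. x \<in> P.agree (?J k)" for c
  proof -
    interpret s: bernoulli A "\<lambda>j. \<rho> (j - c)" by (rule bernoulli_shifted)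
    have ss: "sets s.M = sets M" by (simp add: s.sets_M sets_M)
    have sp: "space s.M = space M" by (simp add: s.space_M space_M)
    have le: "measure s.M (\<Inter>k. disagree n (?J k)) \<le> 8 * real_of_int \<bar>n\<bar> * m (Suc k)" for k
    proof -
      have "measure s.M (\<Inter>k. disagree n (?J k)) \<le> measure s.M (disagree n (?J k))"
        by (intro s.MM.finite_measure_mono) (auto simp: ss)
      also have "\<dots> \<le> 8 * real_of_int \<bar>n\<bar> * m (Suc k)"
      proof (rule measure_disagree)
        fix k' j assume "k' \<le> k" "j \<in> B k'"
        then have "j \<in> Q k" using B_subset_Q by blast
        then show "j \<in> ?J k \<and> j + n \<in> ?J k" by (auto simp: Q_def)
      qed
      finally show ?thesis .
    qed
    have "(\<lambda>k. 8 * real_of_int \<bar>n\<bar> * m (Suc k)) \<longlonglongrightarrow> 0"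
      using m_tendsto by (intro tendsto_mult_right_zero) (rule LIMSEQ_Suc)
    then have "measure s.M (\<Inter>k. disagree n (?J k)) \<le> 0"
      using le by (intro LIMSEQ_le_const) auto
    then have "measure s.M (\<Inter>k. disagree n (?J k)) = 0"
      using measure_nonneg[of s.M "\<Inter>k. disagree n (?J k)"] by linarith
    then have "(\<Inter>k. disagree n (?J k)) \<in> null_sets s.M"
      by (intro null_setsI) (auto simp: s.MM.emeasure_eq_measure ss)
    then show ?thesis
      by (rule AE_I') (auto simp: ag sp)
  qed
  show ?thesis
    using main[of 0, unfolded diff_0_right] main[of n] by unfold_locales auto
qed

end

section \<open>Transitions between cells\<close>

lemma cyl_Int_cyl:
  assumes "I \<inter> J = {}"
  shows "cyl A I u \<inter> cyl A J w = cyl A (I \<union> J) (\<lambda>j. if j \<in> I then u j else w j)"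
  using assms by (auto simp: cyl_def)

lemma (in bernoulli) measure_cyl_Int3:
  assumes "finite I" "finite J" "finite L" "I \<inter> J = {}" "I \<inter> L = {}" "J \<inter> L = {}"
    and "\<And>j. j \<in> I \<Longrightarrow> u j \<in> A" "\<And>j. j \<in> J \<Longrightarrow> w j \<in> A" "\<And>j. j \<in> L \<Longrightarrow> z j \<in> A"
  shows "measure M (cyl A I u \<inter> cyl A J w \<inter> cyl A L z) =
    (\<Prod>j\<in>I. p j (u j)) * ((\<Prod>j\<in>J. p j (w j)) * (\<Prod>j\<in>L. p j (z j)))"
proof -
  have "measure M (cyl A I u \<inter> cyl A (J \<union> L) (\<lambda>j. if j \<in> J then w j else z j)) =
     (\<Prod>j\<in>I. p j (u j)) * (\<Prod>j\<in>J \<union> L. p j (if j \<in> J then w j else z j))"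
    using assms by (intro measure_cyl_Int) auto
  also have "cyl A (J \<union> L) (\<lambda>j. if j \<in> J then w j else z j) = cyl A J w \<inter> cyl A L z"
    using assms by (simp add: cyl_Int_cyl)
  also have "(\<Prod>j\<in>J \<union> L. p j (if j \<in> J then w j else z j)) =
     (\<Prod>j\<in>J. p j (if j \<in> J then w j else z j)) * (\<Prod>j\<in>L. p j (if j \<in> J then w j else z j))"
    using assms by (intro prod.union_disjoint) auto
  also have "(\<Prod>j\<in>L. p j (if j \<in> J then w j else z j)) = (\<Prod>j\<in>L. p j (z j))"
    using assms by (intro prod.cong) auto
  finally show ?thesis by (simp add: Int_assoc)
qed

context lacunary
begin

section \<open>Cells and their translates\<close>

definition "cells k = PiE (Q k) (\<lambda>_. {a \<in> A. idx a \<le> 3 * k + 3})"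
text \<open>\<open>U\<close> is the mass of a word at its own place \<open>Q k\<close>, and
  \<open>V\<close> its mass after translation to a region with unswapped masses.\<close>

definition "U k w = (\<Prod>j\<in>Q k. p j (w j))"
definition "V k w = (\<Prod>j\<in>Q k. v (idx (w j)))"
definition "X k n w = cyl A ((\<lambda>j. j + n) ` Q k) (\<lambda>j. w (j - n))"
text \<open>Positive multiples of the length \<open>d k\<close> of \<open>Q k\<close>, so that the
  translates of \<open>Q k\<close> are disjoint from each other and from \<open>Q k\<close>.\<close>

definition "moves k = (\<lambda>i. int (d k * i)) ` {1..s k}"

lemma card_Q: "card (Q k) = d k"
  by (simp add: Q_def q_def d)

lemma finite_Q [simp]: "finite (Q k)"
  by (simp add: Q_def)

lemma finite_symbols: "finite {a \<in> A. idx a \<le> n}"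
proof -
  have "{a \<in> A. idx a \<le> n} \<subseteq> symbol ` {..n}" using symbol_idx by force
  then show ?thesis by (rule finite_subset) simp
qed

lemma finite_cells: "finite (cells k)"
  by (auto simp: cells_def intro!: finite_PiE finite_symbols)

lemma cells_in_A: "w \<in> cells k \<Longrightarrow> j \<in> Q k \<Longrightarrow> w j \<in> A"
  and cells_idx: "w \<in> cells k \<Longrightarrow> j \<in> Q k \<Longrightarrow> idx (w j) \<le> 3 * k + 3"
  by (auto simp: cells_def)

lemma measure_cell: "w \<in> cells k \<Longrightarrow> measure M (cyl A (Q k) w) = U k w"
  by (simp add: measure_cyl cells_in_A U_def)

lemma g_pos: "0 < g k"
  using m_pos lam_pow by (simp add: g_def)

lemma g_le: assumes "w \<in> cells k" shows "g k \<le> U k w" "g k \<le> V k w"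
proof -
  have *: "g k = (\<Prod>j\<in>Q k. m k * lam ^ k)" by (simp add: g_def card_Q)
  have nn: "0 \<le> m k * lam ^ k" using m_pos[of k] lam_pow[of k] by simp
  show "g k \<le> U k w" unfolding * U_def
    using assms nn by (intro prod_mono) (auto intro: p_ge cells_in_A cells_idx)
  show "g k \<le> V k w" unfolding * V_def
    using assms nn by (intro prod_mono) (auto intro: v_ge cells_idx)
qed

lemma UV_pos: assumes "w \<in> cells k" shows "0 < U k w" "0 < V k w"
  using g_le[OF assms] g_pos[of k] by linarith+

lemma moves: assumes "n \<in> moves k" shows "int (d k) \<le> n" "n \<le> int (d k * s k)"
  using assms by (auto simp: moves_def simp flip: of_nat_mult)

lemma moves_diff: assumes "n \<in> moves k" "n' \<in> moves k" "n \<noteq> n'" shows "int (d k) \<le> \<bar>n - n'\<bar>"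
proof -
  from assms obtain i i' where n: "n = int (d k * i)" "n' = int (d k * i')" by (auto simp: moves_def)
  then have "int (d k) dvd n - n'" by simp
  then show ?thesis using assms(3) zdvd_imp_le[of "int (d k)" "\<bar>n - n'\<bar>"] by simp
qed

lemma card_moves: "card (moves k) = s k"
proof -
  have "d k > 0" by (simp add: d)
  then have "inj_on (\<lambda>i. int (d k * i)) {1..s k}" by (auto simp: inj_on_def)
  then show ?thesis by (simp add: moves_def card_image)
qed

lemma shifted_Q_disjoint:
  assumes "int (d k) \<le> \<bar>n - n'\<bar>"
  shows "(\<lambda>j. j + n) ` Q k \<inter> (\<lambda>j. j + n') ` Q k = {}"
  using assms by (auto simp: Q_def q_def d)

lemma X_iff: "x \<in> X k n w \<longleftrightarrow> x \<in> space M \<and> shift n x \<in> cyl A (Q k) w"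
proof -
  have "(\<forall>j. x (j + n) \<in> A) \<longleftrightarrow> (\<forall>j. x j \<in> A)"
    by (metis diff_add_cancel)
  then show ?thesis by (auto simp: X_def cyl_def space_M shift_def)
qed

lemma measurable_X [measurable]: "X k n w \<in> sets M"
  by (simp add: X_def measurable_cyl)

text \<open>A forward move carries \<open>Q k\<close> into the gap behind it, a backward move to
  negative coordinates; the masses are unswapped in both places.\<close>

lemma prod_shifted:
  assumes "w \<in> cells k" "n \<in> moves k \<or> - n \<in> moves k"
  shows "(\<Prod>j\<in>(\<lambda>j. j + n) ` Q k. p j (w (j - n))) = V k w"
proof -
  have "p (j + n) (w j) = v (idx (w j))" if "j \<in> Q k" for j
  proof (rule p_eq_v_gap[OF cells_in_A[OF assms(1) that], of _ k])
    show "j + n \<le> 0 \<or> q k < j + n \<and> j + n \<le> q k + int (d k * s k)"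
      using assms(2) that moves[of n k] moves[of "- n" k] by (auto simp: Q_def q_def d)
  qed
  then show ?thesis by (simp add: prod.reindex inj_on_def V_def)
qed

lemma measure_cyl_X:
  assumes "w \<in> cells k" "w' \<in> cells k" "n \<in> moves k \<or> - n \<in> moves k"
  shows "measure M (cyl A (Q k) w \<inter> X k n w') = U k w * V k w'"
proof -
  have "int (d k) \<le> \<bar>n - 0\<bar>" using assms(3) moves[of n k] moves[of "- n" k] by auto
  from shifted_Q_disjoint[OF this] show ?thesis
    unfolding X_def prod_shifted[OF assms(2,3), symmetric] U_def
    using assms by (intro measure_cyl_Int) (auto simp: cells_in_A)
qed

lemma measure_cyl_X_X:
  assumes "w \<in> cells k" "w' \<in> cells k" and n: "n \<in> moves k \<and> n' \<in> moves k \<or> - n \<in> moves k \<and> - n' \<in> moves k"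
    and "n \<noteq> n'"
  shows "measure M (cyl A (Q k) w \<inter> X k n w' \<inter> X k n' w') = U k w * (V k w')\<^sup>2"
proof -
  have 1: "int (d k) \<le> \<bar>n - 0\<bar>" "int (d k) \<le> \<bar>n' - 0\<bar>"
    using n moves[of n k] moves[of "- n" k] moves[of n' k] moves[of "- n'" k] by auto
  have 2: "int (d k) \<le> \<bar>n - n'\<bar>"
    using n moves_diff[of n k n'] moves_diff[of "- n" k "- n'"] assms(4) by auto
  have n1: "n \<in> moves k \<or> - n \<in> moves k" and n2: "n' \<in> moves k \<or> - n' \<in> moves k" using n by auto
  show ?thesis
    using shifted_Q_disjoint[OF 1(1)] shifted_Q_disjoint[OF 1(2)] shifted_Q_disjoint[OF 2]
    unfolding X_def power2_eq_square
    apply (subst measure_cyl_Int3)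
    using assms(1,2) apply (auto simp: cells_in_A)[9]
    using prod_shifted[OF assms(2) n1] prod_shifted[OF assms(2) n2] by (simp add: U_def)
qed

text \<open>The second moment estimate with \<open>t\<close> the expected number of visits. The sign
  \<open>e\<close> allows backward moves, by which the defect at the target cell will be
  bounded.\<close>

lemma sum_measure_Diff_cell:
  assumes w: "w \<in> cells k" "w' \<in> cells k" and E: "E \<in> sets M"
    and small: "measure M (cyl A (Q k) w - E) \<le> U k w / 50"
    and e: "e = 1 \<or> e = - 1"
  shows "(\<Sum>n\<in>moves k. measure M ((cyl A (Q k) w - E) \<inter> X k (e * n) w')) \<le> s k * (U k w * V k w') / 5"
proof (rule MM.sum_measure_Int_le[where W="cyl A (Q k) w" and X="\<lambda>n. X k (e * n) w'" and S="moves k"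
      and c="U k w" and P="V k w'" and D="cyl A (Q k) w - E", unfolded card_moves])
  have "1 \<le> s k * g k" using s[of k] by (simp add: g_def)
  also have "\<dots> \<le> s k * V k w'" using g_le[OF w(2)] by (intro mult_left_mono) auto
  finally show "1 \<le> real (s k) * V k w'" .
  then show "moves k \<noteq> {}" using card_moves[of k] by (cases "moves k = {}") simp_all
  show "measure M (cyl A (Q k) w \<inter> X k (e * n) w') = U k w * V k w'" if "n \<in> moves k" for n
    using e that by (intro measure_cyl_X w) auto
  show "measure M (cyl A (Q k) w \<inter> X k (e * n) w' \<inter> X k (e * n') w') = U k w * (V k w')\<^sup>2"
    if "n \<in> moves k" "n' \<in> moves k" "n \<noteq> n'" for n n'
    using e that by (intro measure_cyl_X_X w) auto
  show "finite (moves k)" by (simp add: moves_def)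
  show "0 < V k w'" "0 \<le> U k w" using UV_pos w by (auto intro: less_imp_le)
qed (use E small in auto)

text \<open>Transitions from \<open>w\<close> to \<open>w'\<close> for which only coordinates in
  \<open>Q k\<close> and its translate contribute to the derivative.\<close>

definition "Y k n w w' = (cyl A (Q k) w \<inter> X k n w') - disagree n (Q k \<union> (\<lambda>j. j + n) ` Q k)"

text \<open>
  \<open>\<omega> k w w'\<close> is the derivative of the \<open>n\<close>-th iterate on \<open>Y k n w w'\<close>: the word \<open>w\<close> leaves \<open>Q k\<close> for a
  region where all coordinates have the unswapped law, and \<open>w'\<close> enters \<open>Q k\<close> from such a region.
\<close>

definition "\<omega> k w w' = V k w / U k w * (U k w' / V k w')"

lemma measurable_Y [measurable]: "Y k n w w' \<in> sets M"
  by (auto simp: Y_def)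

text \<open>By \<open>small\<close>, the removed set \<open>disagree\<close> costs at most
  \<open>8 / 50\<close> of \<open>U k w * V k w'\<close>, less than one fifth.\<close>

lemma sum_measure_Y:
  assumes w: "w \<in> cells k" "w' \<in> cells k"
  shows "s k * (U k w * V k w') * (4 / 5) \<le> (\<Sum>n\<in>moves k. measure M (Y k n w w'))"
proof -
  have "U k w * V k w' * (4 / 5) \<le> measure M (Y k n w w')" if n: "n \<in> moves k" for n
  proof -
    let ?J = "Q k \<union> (\<lambda>j. j + n) ` Q k"
    have "measure (bernoulli_space (\<lambda>j. \<rho> (j - 0))) (disagree n ?J) \<le> 8 * real_of_int \<bar>n\<bar> * m (Suc k)"
      using B_subset_Q by (intro measure_disagree) blast
    also have "\<dots> \<le> 8 * real (d k * s k) * m (Suc k)"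
      using moves[OF n] m_pos[of "Suc k"] by (intro mult_right_mono mult_left_mono) linarith+
    also have "\<dots> \<le> (8 / 50) * (g k)\<^sup>2"
      using small[of k] by (simp add: g_def mult_ac)
    also have "\<dots> \<le> (8 / 50) * (U k w * V k w')"
      using g_le[OF w(1)] g_le[OF w(2)] g_pos[of k] unfolding power2_eq_square by (intro mult_left_mono mult_mono) auto
    finally have b: "measure M (disagree n ?J) \<le> (8 / 50) * (U k w * V k w')" by simp
    have "U k w * V k w' = measure M (cyl A (Q k) w \<inter> X k n w')"
      using n by (simp add: measure_cyl_X w)
    also have "\<dots> \<le> measure M (Y k n w w' \<union> disagree n ?J)"
      by (intro MM.finite_measure_mono) (auto simp: Y_def)
    also have "\<dots> \<le> measure M (Y k n w w') + measure M (disagree n ?J)"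
      by (intro measure_Un_le) auto
    finally show ?thesis using b mult_pos_pos[OF UV_pos(1)[OF w(1)] UV_pos(2)[OF w(2)]] by linarith
  qed
  then have "(\<Sum>n\<in>moves k. U k w * V k w' * (4 / 5)) \<le> (\<Sum>n\<in>moves k. measure M (Y k n w w'))"
    by (intro sum_mono)
  then show ?thesis by (simp add: card_moves mult.assoc)
qed

lemma \<omega>_pos: "w \<in> cells k \<Longrightarrow> w' \<in> cells k \<Longrightarrow> 0 < \<omega> k w w'"
  using UV_pos by (simp add: \<omega>_def)

text \<open>On \<open>Q k\<close> the numerators are read \<open>n\<close> to the left, at unswapped
  coordinates; on the translate it is the denominators that are unswapped.\<close>

lemma ratio_Y:
  assumes w: "w \<in> cells k" "w' \<in> cells k" and n: "n \<in> moves k" and x: "x \<in> Y k n w w'"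
  shows "(\<Prod>j\<in>Q k \<union> (\<lambda>j. j + n) ` Q k. p (j - n) (x j) / p j (x j)) = \<omega> k w w'"
proof -
  have dis: "Q k \<inter> (\<lambda>j. j + n) ` Q k = {}"
    using shifted_Q_disjoint[of k 0 n] moves[OF n] by auto
  have 1: "p (j - n) (x j) / p j (x j) = v (idx (w j)) / p j (w j)" if "j \<in> Q k" for j
  proof -
    have "x j = w j" using x that by (auto simp: Y_def cyl_def)
    moreover have "p (j - n) (w j) = v (idx (w j))"
      using moves[OF n] that by (intro p_eq_v_gap[OF cells_in_A[OF w(1) that], of _ k]) (auto simp: Q_def q_def d)
    ultimately show ?thesis by simp
  qed
  have 2: "p j (x (j + n)) / p (j + n) (x (j + n)) = p j (w' j) / v (idx (w' j))" if "j \<in> Q k" for j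
  proof -
    have "x (j + n) = w' j" using x that by (auto simp: Y_def X_def cyl_def)
    moreover have "p (j + n) (w' j) = v (idx (w' j))"
      using moves[OF n] that by (intro p_eq_v_gap[OF cells_in_A[OF w(2) that], of _ k]) (auto simp: Q_def q_def d)
    ultimately show ?thesis by simp
  qed
  have "(\<Prod>j\<in>Q k \<union> (\<lambda>j. j + n) ` Q k. p (j - n) (x j) / p j (x j)) =
     (\<Prod>j\<in>Q k. p (j - n) (x j) / p j (x j)) * (\<Prod>j\<in>(\<lambda>j. j + n) ` Q k. p (j - n) (x j) / p j (x j))"
    using dis by (intro prod.union_disjoint) auto
  also have "(\<Prod>j\<in>(\<lambda>j. j + n) ` Q k. p (j - n) (x j) / p j (x j)) = (\<Prod>j\<in>Q k. p j (x (j + n)) / p (j + n) (x (j + n)))"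
    by (simp add: prod.reindex inj_on_def)
  also have "\<dots> = U k w' / V k w'" using 2 by (simp add: prod_dividef U_def V_def)
  also have "(\<Prod>j\<in>Q k. p (j - n) (x j) / p j (x j)) = V k w / U k w"
    using 1 by (simp add: prod_dividef U_def V_def)
  finally show ?thesis by (simp add: \<omega>_def)
qed

abbreviation "dens n x \<equiv> enn2real (RN_deriv M (bernoulli_space (\<lambda>j. \<rho> (j - n))) x)"

lemma AE_deriv_Y:
  assumes w: "w \<in> cells k" "w' \<in> cells k" and n: "n \<in> moves k"
  shows "AE x in M. x \<in> Y k n w w' \<longrightarrow> dens n x = \<omega> k w w'"
proof -
  interpret P: bernoulli_equiv A \<rho> "\<lambda>j. \<rho> (j - n)" "\<lambda>k. {- q k - \<bar>n\<bar>..q k + \<bar>n\<bar>}"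
    by (rule equiv_shifted)
  let ?J = "Q k \<union> (\<lambda>j. j + n) ` Q k"
  have "AE x in M. x \<in> P.agree ?J \<longrightarrow> dens n x = P.ratio ?J x"
    by (rule P.AE_RN_deriv) simp
  then show ?thesis
  proof eventually_elim
    case (elim x)
    show ?case
    proof
      assume x: "x \<in> Y k n w w'"
      then have "x \<in> P.agree ?J" by (auto simp: Y_def disagree_eq P.agree_def space_M cyl_def)
      then show "dens n x = \<omega> k w w'" using elim ratio_Y[OF w n x] by simp
    qed
  qed
qed

text \<open>The preimage under the inverse shift is the image of \<open>Z\<close> under the
  \<open>n\<close>-th iterate, whose derivative is constant on \<open>Z\<close>.\<close>

lemma measure_shift_Y:
  assumes w: "w \<in> cells k" "w' \<in> cells k" and n: "n \<in> moves k"
    and Z: "Z \<in> sets M" "Z \<subseteq> Y k n w w'"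
  shows "measure M (shift (- n) -` Z \<inter> space M) = \<omega> k w w' * measure M Z"
proof -
  interpret P: bernoulli_equiv A \<rho> "\<lambda>j. \<rho> (j - n)" "\<lambda>k. {- q k - \<bar>n\<bar>..q k + \<bar>n\<bar>}"
    by (rule equiv_shifted)
  let ?J = "Q k \<union> (\<lambda>j. j + n) ` Q k"
  have ZJ: "Z \<inter> P.agree ?J = Z"
    using Z(2) by (auto simp: Y_def disagree_eq P.agree_def space_M cyl_def)
  have "emeasure M (shift (- n) -` Z \<inter> space M) = emeasure P.N.M (Z \<inter> P.agree ?J)"
    using Z by (simp add: ZJ emeasure_shifted)
  also have "\<dots> = (\<integral>\<^sup>+x. ennreal (P.ratio ?J x) * indicator Z x \<partial>M)"
    using P.emeasure_agree[of ?J Z] Z by (simp add: ZJ)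
  also have "\<dots> = (\<integral>\<^sup>+x. ennreal (\<omega> k w w') * indicator Z x \<partial>M)"
    using Z ratio_Y[OF w n] by (intro nn_integral_cong) (auto simp: indicator_def)
  also have "\<dots> = ennreal (\<omega> k w w') * emeasure M Z"
    using Z by (simp add: nn_integral_cmult)
  finally have "ennreal (measure M (shift (- n) -` Z \<inter> space M)) = ennreal (\<omega> k w w' * measure M Z)"
    using \<omega>_pos[OF w] by (simp add: MM.emeasure_eq_measure ennreal_mult)
  then show ?thesis using \<omega>_pos[OF w] by simp
qed

text \<open>Were all the sets in the conclusion null, each \<open>Y\<close> would be covered by
  points that start outside \<open>E\<close> or land outside \<open>F\<close>. Summed over the
  moves, either kind has at most one fifth of the total \<open>s k * (U k w * V k w')\<close>, while
  the \<open>Y\<close> have at least four fifths.\<close>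

lemma exists_transition:
  assumes w: "w \<in> cells k" "w' \<in> cells k" and E: "E \<in> sets M" and F: "F \<in> sets M"
    and wE: "measure M (cyl A (Q k) w - E) \<le> U k w / 50"
    and wF: "measure M (cyl A (Q k) w' - F) \<le> U k w' / 50"
  shows "\<exists>n. 0 < measure M {x \<in> space M. x \<in> E \<and> shift n x \<in> F \<and> dens n x = \<omega> k w w'}"
proof (rule ccontr)
  let ?C = "cyl A (Q k) w" and ?C' = "cyl A (Q k) w'"
  let ?R = "\<lambda>n. {x \<in> space M. x \<in> E \<and> shift n x \<in> F \<and> dens n x = \<omega> k w w'}"
  let ?H = "\<lambda>n. Y k n w w' \<inter> (shift n -` (?C' - F) \<inter> space M)"
  assume "\<not> ?thesis"
  then have "\<not> 0 < measure M (?R n)" for n by blast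
  then have 0: "measure M (?R n) = 0" for n
    by (simp add: zero_less_measure_iff)
  have Fm [measurable]: "(shift n -` F \<inter> space M) \<in> sets M" for n
    using F by (rule measurable_sets[OF measurable_shift])
  have Hm [measurable]: "?H n \<in> sets M" for n
    by (intro sets.Int measurable_Y measurable_sets[OF measurable_shift]) (use F in auto)
  have Rm: "?R n \<in> sets M" for n
  proof -
    have "?R n = (E \<inter> (shift n -` F \<inter> space M)) \<inter> {x \<in> space M. dens n x = \<omega> k w w'}"
      using sets.sets_into_space[OF E] by auto
    also have "\<dots> \<in> sets M" using E by measurable
    finally show ?thesis .
  qed
  have one: "measure M (Y k n w w') \<le> measure M ((?C - E) \<inter> X k (1 * n) w') +
     (1 / \<omega> k w w') * measure M ((?C' - F) \<inter> X k (- 1 * n) w)" if n: "n \<in> moves k" for n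
  proof -
    have "AE x in M. x \<in> Y k n w w' \<longrightarrow> x \<in> ?R n \<union> (((?C - E) \<inter> X k n w') \<union> ?H n)"
      using AE_deriv_Y[OF w n]
    proof eventually_elim
      case (elim x)
      then show ?case by (auto simp: Y_def X_iff)
    qed
    then have "measure M (Y k n w w') \<le> measure M (?R n \<union> (((?C - E) \<inter> X k n w') \<union> ?H n))"
      using E Rm Hm by (intro MM.finite_measure_mono_AE) auto
    also have "\<dots> \<le> measure M (?R n) + measure M (((?C - E) \<inter> X k n w') \<union> ?H n)"
      using E Rm Hm by (intro measure_Un_le) auto
    also have "\<dots> \<le> measure M (?R n) + (measure M ((?C - E) \<inter> X k n w') + measure M (?H n))"
      using E Rm Hm by (intro add_left_mono measure_Un_le) auto
    finally have 1: "measure M (Y k n w w') \<le> measure M ((?C - E) \<inter> X k n w') + measure M (?H n)"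
      using 0 by simp
    \<comment> \<open>Carried forward by \<open>n\<close>, the set \<open>?H n\<close> lies in the
      cell of \<open>w'\<close> outside \<open>F\<close>, and its points see \<open>w\<close> after
      the backward move.\<close>
    have "\<omega> k w w' * measure M (?H n) = measure M (shift (- n) -` ?H n \<inter> space M)"
      using measure_shift_Y[OF w n Hm] by auto
    also have "\<dots> \<le> measure M ((?C' - F) \<inter> X k (- n) w)"
      using F by (intro MM.finite_measure_mono) (auto simp: Y_def X_iff)
    finally have "measure M (?H n) \<le> (1 / \<omega> k w w') * measure M ((?C' - F) \<inter> X k (- n) w)"
      using \<omega>_pos[OF w] by (simp add: field_simps)
    with 1 show ?thesis by simp
  qed
  let ?c = "s k * (U k w * V k w')"
  have "?c * (4 / 5) \<le> (\<Sum>n\<in>moves k. measure M (Y k n w w'))" by (rule sum_measure_Y[OF w])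
  also have "\<dots> \<le> (\<Sum>n\<in>moves k. measure M ((?C - E) \<inter> X k (1 * n) w') +
     (1 / \<omega> k w w') * measure M ((?C' - F) \<inter> X k (- 1 * n) w))"
    using one by (intro sum_mono)
  also have "\<dots> = (\<Sum>n\<in>moves k. measure M ((?C - E) \<inter> X k (1 * n) w')) +
     (1 / \<omega> k w w') * (\<Sum>n\<in>moves k. measure M ((?C' - F) \<inter> X k (- 1 * n) w))"
    by (simp only: sum.distrib sum_distrib_left)
  also have "\<dots> \<le> ?c / 5 + (1 / \<omega> k w w') * (s k * (U k w' * V k w) / 5)"
    using \<omega>_pos[OF w] by (intro add_mono mult_left_mono sum_measure_Diff_cell w E F wE wF) auto
  \<comment> \<open>Dividing by \<omega> converts \<open>U k w' * V k w\<close> into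
    \<open>U k w * V k w'\<close>, so both errors are measured on the same scale.\<close>
  also have "(1 / \<omega> k w w') * (s k * (U k w' * V k w) / 5) = ?c / 5"
    using UV_pos[OF w(1)] UV_pos[OF w(2)] by (simp add: \<omega>_def field_simps)
  finally have "?c \<le> 0" by simp
  moreover have "0 < s k" using s[of k] by (cases "s k = 0") auto
  ultimately show False using UV_pos[OF w(1)] UV_pos[OF w(2)]
    by (auto simp: mult_le_0_iff not_le zero_less_mult_iff)
qed

end

section \<open>Ergodicity and the ratio set\<close>

context lacunary
begin

text \<open>The constant 50 is the one required by the second moment estimate.\<close>

definition "good k E w \<longleftrightarrow> w \<in> cells k \<and> measure M (cyl A (Q k) w - E) \<le> U k w / 50"

definition "cells_in k J W = {w \<in> cells k. restrict w J \<in> W}"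

lemma finite_cells_in: "finite (cells_in k J W)"
  by (simp add: cells_in_def finite_cells)

lemma disjoint_cells: "disjoint_family_on (cyl A (Q k)) (cells k)"
  unfolding cells_def by (rule disjoint_cyl)

lemma measure_UN_cells:
  assumes "G \<subseteq> cells k"
  shows "measure M (\<Union>w\<in>G. cyl A (Q k) w) = (\<Sum>w\<in>G. U k w)"
proof -
  have "measure M (\<Union>w\<in>G. cyl A (Q k) w) = (\<Sum>w\<in>G. measure M (cyl A (Q k) w))"
    using assms finite_subset[OF assms finite_cells] disjoint_family_on_mono[OF assms disjoint_cells]
    by (intro MM.finite_measure_finite_Union) auto
  then show ?thesis using assms by (simp add: measure_cell subset_iff)
qed

text \<open>A Markov-type bound: a cell that is not good has more than one fiftieth of its mass
  outside \<open>E\<close>, and the cells are disjoint subsets of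
  \<open>cylset A J W\<close>.\<close>

lemma sum_bad_le:
  assumes J: "finite J" "J \<subseteq> Q k" and E: "E \<in> sets M"
    and G: "G \<subseteq> cells_in k J W" "\<And>w. w \<in> G \<Longrightarrow> \<not> good k E w"
  shows "(\<Sum>w\<in>G. U k w) \<le> 50 * measure M (cylset A J W - E)"
proof -
  have fin: "finite G" using G(1) finite_cells_in by (rule finite_subset)
  have Gc: "G \<subseteq> cells k" using G(1) by (auto simp: cells_in_def)
  have "(\<Sum>w\<in>G. U k w) \<le> (\<Sum>w\<in>G. 50 * measure M (cyl A (Q k) w - E))"
  proof (rule sum_mono)
    fix w assume w: "w \<in> G"
    then have "\<not> measure M (cyl A (Q k) w - E) \<le> U k w / 50"
      using G(2)[OF w] Gc by (auto simp: good_def)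
    then show "U k w \<le> 50 * measure M (cyl A (Q k) w - E)" by simp
  qed
  also have "\<dots> = 50 * measure M (\<Union>w\<in>G. cyl A (Q k) w - E)"
    unfolding sum_distrib_left[symmetric]
    using fin E disjoint_family_on_mono[OF Gc disjoint_cells]
    by (subst MM.finite_measure_finite_Union) (auto simp: disjoint_family_on_def)
  also have "\<dots> \<le> 50 * measure M (cylset A J W - E)"
  proof (intro mult_left_mono MM.finite_measure_mono)
    have "x \<in> cylset A J W" if w: "w \<in> G" and x: "x \<in> cyl A (Q k) w" for w x
    proof -
      have "restrict x J = restrict w J" using x J(2) by (auto simp: cyl_def restrict_def fun_eq_iff)
      then show ?thesis using x w G(1) by (auto simp: cylset_def cyl_def cells_in_def)
    qed
    then show "(\<Union>w\<in>G. cyl A (Q k) w - E) \<subseteq> cylset A J W - E" by blast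
  qed (use J E in auto)
  finally show ?thesis .
qed

lemma g_le_m: "(g k)\<^sup>2 \<le> m k"
proof -
  let ?b = "m k * lam ^ k"
  have b: "0 \<le> ?b" "?b \<le> m k" "m k \<le> 1"
    using m_pos[of k] lam_pow[of k] m_le_half[of k] by (auto simp: mult_le_cancel_left1)
  have "(g k)\<^sup>2 = ?b ^ (d k * 2)" by (simp add: g_def power_mult)
  also have "\<dots> \<le> ?b ^ 1" using b d[of k] by (intro power_decreasing) auto
  finally show ?thesis using b by simp
qed

lemma s_pos: "0 < s k"
  using s[of k] by (cases "s k = 0") auto

text \<open>These are the points in no cell of level \<open>k\<close>. A union bound over the
  \<open>d k\<close> coordinates suffices, because \<open>small\<close> makes later symbols rare on
  that scale.\<close>

lemma measure_missing:
  "measure M {x \<in> space M. \<exists>j\<in>Q k. 3 * k + 3 < idx (x j)} \<le> m k" (is "measure M ?Z \<le> _")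
proof -
  let ?L = "{a \<in> A. 3 * k + 3 < idx a}"
  have "?Z = (\<Union>j\<in>Q k. box A {j} (\<lambda>_. ?L))" by (auto simp: box_def space_M)
  then have "measure M ?Z \<le> (\<Sum>j\<in>Q k. measure M (box A {j} (\<lambda>_. ?L)))"
    by (simp only:) (intro MM.finite_measure_subadditive_finite, auto)
  also have "\<dots> = (\<Sum>j\<in>Q k. measure (\<rho> j) ?L)"
    by (intro sum.cong refl) (subst measure_box, auto)
  also have "\<dots> \<le> (\<Sum>j\<in>Q k. 6 * m (Suc k))" by (intro sum_mono measure_large_symbols)
  also have "\<dots> = 6 * m (Suc k) * d k" by (simp add: card_Q)
  also have "\<dots> \<le> 50 * m (Suc k) * (d k * s k)"
    using s_pos[of k] m_pos[of "Suc k"] by (intro mult_mono) (auto simp flip: of_nat_mult)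
  also have "\<dots> \<le> (g k)\<^sup>2" using small[of k] by (simp add: g_def)
  finally show ?thesis using g_le_m[of k] by linarith
qed

lemma measurable_missing [measurable]: "{x \<in> space M. \<exists>j\<in>Q k. 3 * k + 3 < idx (x j)} \<in> sets M"
proof -
  have "{x \<in> space M. \<exists>j\<in>Q k. 3 * k + 3 < idx (x j)} = (\<Union>j\<in>Q k. box A {j} (\<lambda>_. {a. 3 * k + 3 < idx a}))"
    by (auto simp: box_def space_M)
  then show ?thesis by auto
qed

lemma cell_of_point:
  assumes "x \<in> cylset A J W" "J \<subseteq> Q k" "\<And>j. j \<in> Q k \<Longrightarrow> idx (x j) \<le> 3 * k + 3"
  shows "restrict x (Q k) \<in> cells_in k J W" "x \<in> cyl A (Q k) (restrict x (Q k))"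
proof -
  have "restrict (restrict x (Q k)) J = restrict x J" using assms(2) by (auto simp: restrict_def fun_eq_iff)
  then show "restrict x (Q k) \<in> cells_in k J W"
    using assms by (auto simp: cells_in_def cells_def cylset_def)
  show "x \<in> cyl A (Q k) (restrict x (Q k))" using assms by (auto simp: cyl_def cylset_def)
qed

text \<open>The cells of \<open>G\<close> cover \<open>cylset A J W\<close> except for
  \<open>Z\<close> and the points in no cell. \<open>Z\<close> will be empty or the event that the
  cell has no letter to exchange.\<close>

lemma sum_inside_ge:
  assumes J: "finite J" "J \<subseteq> Q k"
    and Z: "Z \<in> sets M" and G: "G \<subseteq> cells_in k J W"
    and cov: "\<And>x. x \<in> cylset A J W \<Longrightarrow> x \<notin> Z \<Longrightarrow> restrict x (Q k) \<in> cells_in k J W \<Longrightarrow> restrict x (Q k) \<in> G"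
  shows "measure M (cylset A J W) - measure M (cylset A J W \<inter> Z) - m k \<le> (\<Sum>w\<in>G. U k w)"
proof -
  let ?Z = "{x \<in> space M. \<exists>j\<in>Q k. 3 * k + 3 < idx (x j)}"
  let ?C = "cylset A J W" and ?G = "\<Union>w\<in>G. cyl A (Q k) w"
  have fin: "finite G" using G finite_cells_in by (rule finite_subset)
  have Gm: "?G \<in> sets M" using fin by auto
  have "?C \<subseteq> ?G \<union> ((?C \<inter> Z) \<union> ?Z)"
  proof
    fix x assume x: "x \<in> ?C"
    show "x \<in> ?G \<union> ((?C \<inter> Z) \<union> ?Z)"
    proof (cases "x \<in> Z \<or> x \<in> ?Z")
      case False
      then have "idx (x j) \<le> 3 * k + 3" if "j \<in> Q k" for j
        using x that by (force simp: cylset_def space_M)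
      from cell_of_point[OF x J(2) this] show ?thesis using cov[OF x] False by blast
    qed (use x in auto)
  qed
  then have "measure M ?C \<le> measure M (?G \<union> ((?C \<inter> Z) \<union> ?Z))"
    using Gm Z J by (intro MM.finite_measure_mono) auto
  also have "\<dots> \<le> measure M ?G + measure M ((?C \<inter> Z) \<union> ?Z)"
    using Gm Z J by (intro measure_Un_le) auto
  also have "\<dots> \<le> measure M ?G + (measure M (?C \<inter> Z) + measure M ?Z)"
    using Z J by (intro add_left_mono measure_Un_le) auto
  also have "measure M ?G = (\<Sum>w\<in>G. U k w)"
    using G by (intro measure_UN_cells) (auto simp: cells_in_def)
  finally show ?thesis using measure_missing[of k] by linarith
qed

lemma Q_exhausts: assumes "finite J" shows "\<exists>k0. \<forall>k\<ge>k0. J \<subseteq> Q k"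
proof -
  define b where "b = (\<Sum>j\<in>J. \<bar>j\<bar>)"
  have b: "\<bar>j\<bar> \<le> b" if "j \<in> J" for j
    unfolding b_def using that assms by (intro member_le_sum) auto
  have "J \<subseteq> Q k" if "nat b \<le> k" for k
  proof
    fix j assume "j \<in> J"
    then have "\<bar>j\<bar> \<le> q k" using b[of j] q_ge[of k] that by linarith
    then show "j \<in> Q k" by (auto simp: Q_def)
  qed
  then show ?thesis by blast
qed

lemma cylset_approximant:
  assumes E: "E \<in> sets M" and e: "0 < e"
  obtains J W where "finite J" "measure M (cylset A J W - E) < e" "measure M E - e < measure M (cylset A J W)"
proof -
  obtain J W where J: "finite J" and
    W: "measure M ((E - cylset A J W) \<union> (cylset A J W - E)) < e"
    using approximation_by_cylset[OF E e] by blast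
  have 1: "measure M (cylset A J W - E) \<le> measure M ((E - cylset A J W) \<union> (cylset A J W - E))"
    using E J by (intro MM.finite_measure_mono) auto
  have "measure M E \<le> measure M (cylset A J W \<union> ((E - cylset A J W) \<union> (cylset A J W - E)))"
    using E J by (intro MM.finite_measure_mono) auto
  also have "\<dots> \<le> measure M (cylset A J W) + measure M ((E - cylset A J W) \<union> (cylset A J W - E))"
    using E J by (intro measure_Un_le) auto
  finally show ?thesis using 1 W by (intro that[OF J, of W]) linarith+
qed

text \<open>If all cells inside the approximating set were bad, their mass would be at most half of
  that of \<open>E\<close>, yet they carry at least 89 percent of it. Having this at all large
  levels lets two sets share a level.\<close>

lemma eventually_good_cell:
  assumes E: "E \<in> sets M" "0 < measure M E"
  shows "\<exists>k0. \<forall>k\<ge>k0. \<exists>w. good k E w"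
proof -
  let ?e = "measure M E / 100"
  obtain J W where J: "finite J" and W: "measure M (cylset A J W - E) < ?e"
      "measure M E - ?e < measure M (cylset A J W)"
    using cylset_approximant[OF E(1), of ?e] E(2) by auto
  obtain k1 where k1: "\<And>k. k \<ge> k1 \<Longrightarrow> J \<subseteq> Q k" using Q_exhausts[OF J] by blast
  have "\<forall>\<^sub>F k in sequentially. m k < measure M E / 10"
    using m_tendsto E(2) by (intro order_tendstoD(2)) auto
  then obtain k2 where k2: "\<And>k. k \<ge> k2 \<Longrightarrow> m k < measure M E / 10"
    by (auto simp: eventually_sequentially)
  have "\<exists>w. good k E w" if k: "k \<ge> max k1 k2" for k
  proof (rule ccontr)
    assume "\<nexists>w. good k E w"
    then have "(\<Sum>w\<in>cells_in k J W. U k w) \<le> 50 * measure M (cylset A J W - E)"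
      using k1[of k] k by (intro sum_bad_le J E) auto
    moreover have "measure M (cylset A J W) - measure M (cylset A J W \<inter> {}) - m k \<le> (\<Sum>w\<in>cells_in k J W. U k w)"
      using k1[of k] k J by (intro sum_inside_ge) auto
    ultimately show False using W E(2) k2[of k] k by simp
  qed
  then show ?thesis by blast
qed

text \<open>
  Exchanging \<open>sa k\<close> and \<open>sc k\<close> at the first coordinate of \<open>B k\<close> carrying one of them changes
  the derivative of a cell by the factor \<open>lam ^ r k\<close>.
\<close>

definition "sa k = symbol (Suc (3 * k))"
definition "sc k = symbol (Suc (Suc (Suc (3 * k))))"
definition "sites k w = {j \<in> B k. w j = sa k \<or> w j = sc k}"
definition "site k w = Min (sites k w)"
definition "flip k w = w(site k w := (if w (site k w) = sa k then sc k else sa k))"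

lemma sa_neq_sc: "sa k \<noteq> sc k"
proof
  assume "sa k = sc k"
  then have "idx (sa k) = idx (sc k)" by simp
  then show False by (simp add: sa_def sc_def symbol)
qed

lemma sites_flip: assumes "sites k w \<noteq> {}" shows "sites k (flip k w) = sites k w"
    and "site k w \<in> B k" and "w (site k w) = sa k \<or> w (site k w) = sc k"
proof -
  have "finite (sites k w)" by (rule finite_subset[of _ "B k"]) (auto simp: sites_def B)
  then have "site k w \<in> sites k w" using assms by (simp add: site_def)
  then show "sites k (flip k w) = sites k w" "site k w \<in> B k" "w (site k w) = sa k \<or> w (site k w) = sc k"
    by (auto simp: sites_def flip_def)
qed

text \<open>An exchange preserves the set of sites, hence its minimum, so the second flip acts at
  the same coordinate.\<close>

lemma flip_flip: assumes "sites k w \<noteq> {}" shows "flip k (flip k w) = w"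
proof -
  have "site k (flip k w) = site k w" by (simp add: site_def sites_flip(1)[OF assms])
  then show ?thesis using sites_flip(3)[OF assms] sa_neq_sc[of k] by (auto simp: flip_def fun_eq_iff)
qed

lemma p_sa: "j \<in> B k \<Longrightarrow> p j (sa k) = m k * lam ^ r k"
  and p_sc: "p j (sc k) = m k"
  by (simp_all add: sa_def sc_def measure_symbol v_b v_c)

lemma flip_in_inside:
  assumes w: "w \<in> cells_in k J W" "sites k w \<noteq> {}" and J: "J \<inter> B k = {}"
  shows "flip k w \<in> cells_in k J W"
proof -
  let ?j = "site k w"
  have j: "?j \<in> B k" "?j \<in> Q k" "?j \<notin> J" using sites_flip(2)[OF w(2)] B_subset_Q[of k k] J by auto
  have "restrict (flip k w) J = restrict w J" using j by (auto simp: flip_def restrict_def fun_eq_iff)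
  moreover have "flip k w \<in> cells k"
    using w(1) j symbol unfolding flip_def cells_def cells_in_def
    by (auto simp: sa_def sc_def PiE_def extensional_def Pi_def)
  ultimately show ?thesis using w(1) by (auto simp: cells_in_def)
qed

text \<open>\<open>sa k\<close> and \<open>sc k\<close> have equal unswapped masses, so
  \<open>V\<close> is unchanged; inside \<open>B k\<close> only \<open>sa k\<close> is lighter, by
  the factor \<open>lam ^ r k\<close>.\<close>

lemma U_V_flip:
  assumes w: "sites k w \<noteq> {}"
  shows "V k (flip k w) = V k w"
    and "w (site k w) = sc k \<Longrightarrow> U k (flip k w) = lam ^ r k * U k w"
    and "w (site k w) = sa k \<Longrightarrow> U k w = lam ^ r k * U k (flip k w)"
proof -
  let ?j = "site k w"
  have j: "?j \<in> Q k" "?j \<in> B k" using sites_flip(2)[OF w] B_subset_Q[of k k] by auto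
  have off: "flip k w i = w i" if "i \<noteq> ?j" for i using that by (simp add: flip_def)
  have at: "flip k w ?j = (if w ?j = sa k then sc k else sa k)" by (simp add: flip_def)
  have U: "U k u = p ?j (u ?j) * (\<Prod>i\<in>Q k - {?j}. p i (u i))" for u
    unfolding U_def using j by (simp add: prod.remove)
  have V: "V k u = v (idx (u ?j)) * (\<Prod>i\<in>Q k - {?j}. v (idx (u i)))" for u
    unfolding V_def using j by (simp add: prod.remove)
  have Ue: "(\<Prod>i\<in>Q k - {?j}. p i (flip k w i)) = (\<Prod>i\<in>Q k - {?j}. p i (w i))"
    and Ve: "(\<Prod>i\<in>Q k - {?j}. v (idx (flip k w i))) = (\<Prod>i\<in>Q k - {?j}. v (idx (w i)))"
    by (auto intro!: prod.cong simp: off)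
  have "v (idx (sa k)) = m k" "v (idx (sc k)) = m k" by (simp_all add: sa_def sc_def symbol v_a v_c)
  then show "V k (flip k w) = V k w"
    unfolding V[of "flip k w"] V[of w] Ve using at sites_flip(3)[OF w] by auto
  show "U k (flip k w) = lam ^ r k * U k w" if "w ?j = sc k"
    unfolding U[of "flip k w"] U[of w] Ue using at that sa_neq_sc[of k] j(2) by (simp add: p_sa p_sc)
  show "U k w = lam ^ r k * U k (flip k w)" if "w ?j = sa k"
    unfolding U[of "flip k w"] U[of w] Ue using at that sa_neq_sc[of k] j(2) by (simp add: p_sa p_sc)
qed

text \<open>\<open>B k\<close> is independent of \<open>J\<close>, and the at least
  \<open>1 / m k\<close> coordinates of \<open>B k\<close> each avoid \<open>sc k\<close> with
  probability \<open>1 - m k\<close>, giving at most \<open>exp (- 1)\<close>.\<close>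

lemma measure_no_sites:
  assumes J: "finite J" "J \<inter> B k = {}"
  shows "measure M (cylset A J W \<inter> box A (B k) (\<lambda>_. A - {sa k, sc k})) \<le> measure M (cylset A J W) / 2"
proof -
  have fB: "finite (B k)" and cB: "card (B k) = l k" by (simp_all add: B)
  have "measure M (cylset A J W \<inter> box A (B k) (\<lambda>_. A - {sa k, sc k})) =
      measure M (cylset A J W) * (\<Prod>j\<in>B k. measure (\<rho> j) (A - {sa k, sc k}))"
    using J fB by (intro measure_cylset_Int_box) auto
  also have "(\<Prod>j\<in>B k. measure (\<rho> j) (A - {sa k, sc k})) \<le> (\<Prod>j\<in>B k. exp (- m k))"
  proof (intro prod_mono conjI)
    fix j
    have "measure (\<rho> j) (A - {sa k, sc k}) \<le> measure (\<rho> j) (A - {sc k})"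
      by (intro PP.M.finite_measure_mono) auto
    also have "\<dots> = 1 - m k"
      using PP.M.prob_compl[of "{sc k}" j] symbol by (simp add: sc_def p_sc[unfolded sc_def])
    also have "\<dots> \<le> exp (- m k)" using exp_ge_add_one_self[of "- m k"] by simp
    finally show "measure (\<rho> j) (A - {sa k, sc k}) \<le> exp (- m k)" .
  qed simp
  also have "\<dots> = exp (- (m k * l k))" by (simp add: cB exp_of_nat_mult[symmetric] mult.commute)
  also have "\<dots> \<le> exp (- 1)" using l[of k] by simp
  also have "\<dots> \<le> 1 / 2" using exp_ge_add_one_self[of "1::real"] by (simp add: exp_minus field_simps)
  finally show ?thesis by (simp add: mult_left_mono)
qed

text \<open>If each flip pair contained a bad cell, the cells with a site would be covered by the
  bad cells and their flips. Flipping distorts masses by at most \<open>1 / lam ^ n\<close>, so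
  their total would be too small.\<close>

lemma exists_flip_pair:
  assumes E: "E \<in> sets M" "0 < measure M E"
  shows "\<exists>k w w'. good k E w \<and> good k E w' \<and> \<omega> k w w' = lam ^ n \<and> \<omega> k w' w = 1 / lam ^ n"
proof -
  \<comment> \<open>The factor \<open>lam ^ n\<close> compensates the distortion of masses under
    \<open>flip\<close>.\<close>
  let ?e = "measure M E * lam ^ n / 1000"
  have ln: "0 < lam ^ n" "lam ^ n \<le> 1" using lam_pow by auto
  obtain J W where J: "finite J" and W: "measure M (cylset A J W - E) < ?e"
      "measure M E - ?e < measure M (cylset A J W)"
    using cylset_approximant[OF E(1), of ?e] E(2) ln by auto
  let ?C = "cylset A J W"
  obtain k1 where k1: "\<And>k. k \<ge> k1 \<Longrightarrow> J \<subseteq> Q k" using Q_exhausts[OF J] by blast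
  have "\<forall>\<^sub>F k in sequentially. m k < measure M E / 10"
    using m_tendsto E(2) by (intro order_tendstoD(2)) auto
  then obtain k2 where k2: "\<And>k. k \<ge> k2 \<Longrightarrow> m k < measure M E / 10"
    by (auto simp: eventually_sequentially)
  \<comment> \<open>Choosing \<open>k\<close> beyond \<open>k1\<close> places \<open>B k\<close>
    outside \<open>Q k1\<close>, which contains \<open>J\<close>.\<close>
  obtain k where k: "k \<ge> max (Suc k1) k2" "r k = n" using r_inf by blast
  have JQ: "J \<subseteq> Q k" "J \<subseteq> Q k1" using k1[of k] k1[of k1] k by auto
  have JB: "J \<inter> B k = {}"
    using JQ(2) q_less_N[of k1 k] k(1) by (fastforce simp: Q_def B)
  define G where "G = {w \<in> cells_in k J W. sites k w \<noteq> {}}"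
  define Bd where "Bd = {w \<in> cells_in k J W. \<not> good k E w}"
  have G: "finite G" "finite Bd" by (simp_all add: G_def Bd_def finite_cells_in)
  have fG: "flip k w \<in> G" if "w \<in> G" for w
    using that flip_in_inside[OF _ _ JB] sites_flip(1) by (auto simp: G_def)
  have UG: "0 < U k w" "0 < V k w" if "w \<in> G" for w
    using that UV_pos[of w k] by (auto simp: G_def cells_in_def)
  have "\<exists>w\<in>G. good k E w \<and> good k E (flip k w)"
  proof (rule ccontr)
    assume "\<not> ?thesis"
    then have bad: "w \<in> Bd \<or> flip k w \<in> Bd" if "w \<in> G" for w
      using that fG[OF that] by (auto simp: G_def Bd_def)
    have bm: "(\<Sum>w\<in>Bd. U k w) \<le> 50 * measure M (?C - E)"
      by (rule sum_bad_le[OF J JQ(1) E(1)]) (auto simp: Bd_def)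
    have Ub: "0 \<le> U k w" if "w \<in> Bd" for w
      using that UV_pos[of w k] by (auto simp: Bd_def cells_in_def intro: less_imp_le)
    let ?G' = "{w \<in> G. flip k w \<in> Bd}"
    have "(\<Sum>w\<in>G. U k w) \<le> (\<Sum>w\<in>Bd \<union> ?G'. U k w)"
      using G bad UG(1) Ub by (intro sum_mono2) (auto intro: less_imp_le)
    also have "\<dots> \<le> (\<Sum>w\<in>Bd. U k w) + (\<Sum>w\<in>?G'. U k w)"
    proof -
      have "0 \<le> (\<Sum>w\<in>Bd \<inter> ?G'. U k w)" using Ub by (intro sum_nonneg) auto
      then show ?thesis using sum.union_inter[of Bd ?G' "U k"] G by simp
    qed
    also have "(\<Sum>w\<in>?G'. U k w) \<le> (\<Sum>w\<in>?G'. (1 / lam ^ n) * U k (flip k w))"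
    proof (rule sum_mono)
      fix w assume "w \<in> ?G'"
      then have w: "w \<in> G" "sites k w \<noteq> {}" by (auto simp: G_def)
      have "w (site k w) = sa k \<or> w (site k w) = sc k" by (rule sites_flip(3)[OF w(2)])
      then show "U k w \<le> (1 / lam ^ n) * U k (flip k w)"
      proof
        assume "w (site k w) = sc k"
        then show ?thesis using U_V_flip(2)[OF w(2)] k(2) lam(1) by simp
      next
        assume "w (site k w) = sa k"
        then have "U k w = lam ^ n * U k (flip k w)" using U_V_flip(3)[OF w(2)] k(2) by simp
        also have "\<dots> \<le> (1 / lam ^ n) * U k (flip k w)"
        proof (rule mult_right_mono)
          have "lam ^ n * lam ^ n \<le> 1" using mult_le_one[of "lam ^ n" "lam ^ n"] ln by simp
          then show "lam ^ n \<le> 1 / lam ^ n" using ln by (simp add: field_simps)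
        qed (use UG(1)[OF fG[OF w(1)]] in simp)
        finally show ?thesis .
      qed
    qed
    also have "\<dots> = (1 / lam ^ n) * (\<Sum>w\<in>flip k ` ?G'. U k w)"
    proof -
      have "inj_on (flip k) ?G'"
        by (rule inj_on_inverseI[of _ "flip k"]) (auto simp: G_def flip_flip)
      then show ?thesis by (simp add: sum.reindex sum_distrib_left)
    qed
    also have "\<dots> \<le> (1 / lam ^ n) * (\<Sum>w\<in>Bd. U k w)"
      using ln G Ub by (intro mult_left_mono sum_mono2) auto
    finally have "(\<Sum>w\<in>G. U k w) \<le> (1 + 1 / lam ^ n) * (\<Sum>w\<in>Bd. U k w)"
      by (simp add: algebra_simps)
    also have "\<dots> \<le> (1 + 1 / lam ^ n) * (50 * ?e)"
    proof (rule mult_left_mono)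
      show "(\<Sum>w\<in>Bd. U k w) \<le> 50 * ?e" using bm W(1) by linarith
    qed (use ln in simp)
    also have "\<dots> = (lam ^ n + 1) * (50 * (measure M E / 1000))"
      using lam(1) by (simp add: field_simps)
    also have "\<dots> \<le> 2 * (50 * (measure M E / 1000))"
      using ln by (intro mult_right_mono) auto
    finally have 1: "(\<Sum>w\<in>G. U k w) \<le> measure M E / 10" by simp
    have "measure M ?C - measure M (?C \<inter> box A (B k) (\<lambda>_. A - {sa k, sc k})) - m k \<le> (\<Sum>w\<in>G. U k w)"
    proof (rule sum_inside_ge[OF J JQ(1)])
      show "G \<subseteq> cells_in k J W" by (auto simp: G_def)
      fix x assume x: "x \<in> ?C" "x \<notin> box A (B k) (\<lambda>_. A - {sa k, sc k})" "restrict x (Q k) \<in> cells_in k J W"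
      then obtain j where "j \<in> B k" "x j = sa k \<or> x j = sc k"
        by (auto simp: box_def cylset_def)
      then have "j \<in> sites k (restrict x (Q k))" using B_subset_Q[of k k] by (auto simp: sites_def)
      then show "restrict x (Q k) \<in> G" using x(3) by (auto simp: G_def)
    qed auto
    \<comment> \<open>At least half of the approximating set, up to \<open>m k\<close>, lies in
      cells with a site; this contradicts the bound \<open>measure M E / 10\<close>.\<close>
    then have "measure M ?C / 2 - m k \<le> (\<Sum>w\<in>G. U k w)"
      using measure_no_sites[OF J JB, of W] by linarith
    moreover have "?e \<le> measure M E / 1000" using ln E(2) by simp
    moreover have "m k < measure M E / 10" using k2[of k] k(1) by simp
    ultimately show False using 1 W(2) E(2) by linarith
  qed
  then obtain w where w: "w \<in> G" "good k E w" "good k E (flip k w)" by blast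
  then have ws: "sites k w \<noteq> {}" by (simp add: G_def)
  note P = UG[OF w(1)] UG[OF fG[OF w(1)]]
  from sites_flip(3)[OF ws] show ?thesis
  proof
    assume "w (site k w) = sc k"
    then have "U k (flip k w) = lam ^ n * U k w" using U_V_flip(2)[OF ws] k(2) by simp
    then have "\<omega> k w (flip k w) = lam ^ n" "\<omega> k (flip k w) w = 1 / lam ^ n"
      using P U_V_flip(1)[OF ws] ln by (simp_all add: \<omega>_def)
    then show ?thesis using w by blast
  next
    assume "w (site k w) = sa k"
    then have "U k w = lam ^ n * U k (flip k w)" using U_V_flip(3)[OF ws] k(2) by simp
    then have "\<omega> k (flip k w) w = lam ^ n" "\<omega> k w (flip k w) = 1 / lam ^ n"
      using P U_V_flip(1)[OF ws] ln by (simp_all add: \<omega>_def)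
    then show ?thesis using w by blast
  qed
qed

section \<open>Nonsingularity, ergodicity and essential values\<close>

lemma transition_of_good:
  assumes "good k E w" "good k F w'" "E \<in> sets M" "F \<in> sets M"
  shows "\<exists>n. 0 < measure M {x \<in> space M. x \<in> E \<and> shift n x \<in> F \<and> dens n x = \<omega> k w w'}"
  using assms by (intro exists_transition) (auto simp: good_def)

lemma ergodic: "ergodic_action M T"
  unfolding ergodic_action_def
proof (intro ballI impI)
  fix E assume E: "E \<in> sets M" and inv: "\<forall>g. emeasure M ((E - T g ` E) \<union> (T g ` E - E)) = 0"
  show "emeasure M E = 0 \<or> emeasure M (space M - E) = 0"
  proof (rule ccontr)
    assume "\<not> ?thesis"
    then have pos: "0 < measure M E" "0 < measure M (space M - E)"
      by (auto simp: MM.emeasure_eq_measure zero_less_measure_iff)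
    \<comment> \<open>An invariant set and its complement, both nonnull, have good cells at a common
      level; a transition between these contradicts invariance.\<close>
    obtain k1 k2 where "\<And>k. k \<ge> k1 \<Longrightarrow> \<exists>w. good k E w" "\<And>k. k \<ge> k2 \<Longrightarrow> \<exists>w. good k (space M - E) w"
      using eventually_good_cell[of E] eventually_good_cell[of "space M - E"] E pos by blast
    then obtain w w' where "good (max k1 k2) E w" "good (max k1 k2) (space M - E) w'"
      by (meson max.cobounded1 max.cobounded2)
    from transition_of_good[OF this] E obtain n where
      n: "0 < measure M {x \<in> space M. x \<in> E \<and> shift n x \<in> space M - E \<and> dens n x = \<omega> (max k1 k2) w w'}" (is "0 < measure M ?R")
      by blast
    have TE: "T (- n) ` E \<in> sets M"
      unfolding measurable_action_image[OF measurable_action_T E]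
      using measurable_action_T E by (auto simp: measurable_action_def intro: measurable_sets)
    \<comment> \<open>The image under \<open>T (- n)\<close> is the preimage under
      \<open>T n\<close>, so points of \<open>E\<close> leaving \<open>E\<close> lie in this
      symmetric difference.\<close>
    have "?R \<subseteq> (E - T (- n) ` E) \<union> (T (- n) ` E - E)"
      unfolding measurable_action_image[OF measurable_action_T E] by (auto simp: T_eq)
    then have "emeasure M ?R \<le> emeasure M ((E - T (- n) ` E) \<union> (T (- n) ` E - E))"
      using E TE by (intro emeasure_mono) auto
    then show False using inv n by (simp add: MM.emeasure_eq_measure)
  qed
qed

lemma nonsingular: "nonsingular_action M T"
proof -
  have "null_sets (translate_measure M T n) = null_sets M" for n
  proof -
    interpret P: bernoulli_equiv A \<rho> "\<lambda>j. \<rho> (j - n)" "\<lambda>k. {- q k - \<bar>n\<bar>..q k + \<bar>n\<bar>}"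
      by (rule equiv_shifted)
    show ?thesis unfolding translate_measure_T by (rule P.null_sets_eq)
  qed
  then show ?thesis
    unfolding nonsingular_action_def using measurable_action_T MM.sigma_finite_measure_axioms by blast
qed

lemma log_derivative_eq: "log_derivative M T n x = ln (dens n x)"
  by (simp add: log_derivative_def translate_measure_T)

lemma ln_lam_powi: "ln (lam powi z) = of_int z * ln lam"
  using lam by (simp add: powr_real_of_int'[symmetric] ln_powr)

text \<open>The value is attained exactly on a nonnull set. The two directions of one flip pair give
  the two signs of \<open>z\<close>.\<close>

lemma essential_value_powi: "essential_value M T (of_int z * ln lam)"
  unfolding essential_value_def
proof (intro ballI impI allI)
  fix E and \<epsilon> :: real assume E: "E \<in> sets M" "0 < emeasure M E" and \<epsilon>: "0 < \<epsilon>"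
  have E': "0 < measure M E" using E(2) by (simp add: MM.emeasure_eq_measure)
  obtain k w w' where g: "good k E w" "good k E w'" and w: "\<omega> k w w' = lam ^ nat \<bar>z\<bar>" "\<omega> k w' w = 1 / lam ^ nat \<bar>z\<bar>"
    using exists_flip_pair[OF E(1) E'] by blast
  have "\<exists>n. 0 < measure M {x \<in> space M. x \<in> E \<and> shift n x \<in> E \<and> dens n x = lam powi z}"
  proof (cases "0 \<le> z")
    case True
    then show ?thesis using transition_of_good[OF g E(1) E(1)] w by (simp add: power_int_def)
  next
    case False
    then show ?thesis using transition_of_good[OF g(2,1) E(1) E(1)] w by (simp add: power_int_def divide_inverse power_inverse)
  qed
  then obtain n where n: "0 < measure M {x \<in> space M. x \<in> E \<and> shift n x \<in> E \<and> dens n x = lam powi z}" (is "0 < measure M ?R") ..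
  let ?S = "E \<inter> T n -` E \<inter> {x \<in> space M. \<bar>log_derivative M T n x - of_int z * ln lam\<bar> < \<epsilon>}"
  have lz: "ln (lam powi z) = of_int z * ln lam" by (rule ln_lam_powi)
  have S: "?S \<in> sets M"
  proof -
    have "?S = E \<inter> (T n -` E \<inter> space M) \<inter> {x \<in> space M. \<bar>log_derivative M T n x - of_int z * ln lam\<bar> < \<epsilon>}" by auto
    also have "\<dots> \<in> sets M"
      unfolding log_derivative_eq
      using measurable_action_T E(1)
      by (intro sets.Int measurable_sets[of "T n" M M]) (auto simp: measurable_action_def)
    finally show ?thesis .
  qed
  have "measure M ?R \<le> measure M ?S"
    using S \<epsilon> by (intro MM.finite_measure_mono) (auto simp: T_eq log_derivative_eq lz)
  then have "0 < emeasure M ?S" using n by (simp add: MM.emeasure_eq_measure)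
  then show "\<exists>g. 0 < emeasure M (E \<inter> T g -` E \<inter> {x \<in> space M. \<bar>log_derivative M T g x - of_int z * ln lam\<bar> < \<epsilon>})"
    by blast
qed

lemma ratio_powi:
  assumes "finite J" "\<And>j. x j \<in> A"
  shows "\<exists>z. (\<Prod>j\<in>J. p (j - n) (x j) / p j (x j)) = lam powi z"
  using assms(1)
proof induction
  case empty
  then show ?case by (intro exI[of _ 0]) simp
next
  case (insert i J)
  obtain z1 z2 where "p (i - n) (x i) = v (idx (x i)) * lam powi z1" "p i (x i) = v (idx (x i)) * lam powi z2"
    using p_powi[OF assms(2)] by meson
  then have "p (i - n) (x i) / p i (x i) = lam powi (z1 - z2)"
    using v_pos[of "idx (x i)"] lam by (simp add: power_int_diff)
  moreover obtain z where "(\<Prod>j\<in>J. p (j - n) (x j) / p j (x j)) = lam powi z" using insert.IH by blast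
  ultimately have "(\<Prod>j\<in>insert i J. p (j - n) (x j) / p j (x j)) = lam powi (z1 - z2 + z)"
    using insert.hyps lam by (simp add: power_int_add)
  then show ?case by blast
qed

text \<open>Almost every point lies in some \<open>agree\<close> set, where the derivative is a
  finite product of powers of \<open>lam\<close>.\<close>

lemma AE_log_derivative: "AE x in M. \<exists>z::int. log_derivative M T n x = of_int z * ln lam"
proof -
  interpret P: bernoulli_equiv A \<rho> "\<lambda>j. \<rho> (j - n)" "\<lambda>k. {- q k - \<bar>n\<bar>..q k + \<bar>n\<bar>}"
    by (rule equiv_shifted)
  let ?J = "\<lambda>k. {- q k - \<bar>n\<bar>..q k + \<bar>n\<bar>}"
  have "AE x in M. \<forall>k. x \<in> P.agree (?J k) \<longrightarrow> dens n x = P.ratio (?J k) x"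
    unfolding AE_all_countable by (intro allI P.AE_RN_deriv) simp
  with P.AE_agree AE_space show ?thesis
  proof eventually_elim
    case (elim x)
    then obtain k where "dens n x = P.ratio (?J k) x" by blast
    moreover obtain z where "P.ratio (?J k) x = lam powi z"
      using ratio_powi[of "?J k" x n] elim(2) by (auto simp: space_M)
    ultimately have "dens n x = lam powi z" by simp
    then have "log_derivative M T n x = of_int z * ln lam"
      by (simp add: log_derivative_eq ln_lam_powi)
    then show ?case ..
  qed
qed

lemma essential_value_only:
  assumes "essential_value M T t" shows "\<exists>z::int. t = of_int z * ln lam"
proof (rule ccontr)
  assume no: "\<not> ?thesis"
  have L: "ln lam < 0" using lam by simp
  define y where "y = t / ln lam"
  have t: "t = y * ln lam" using L by (simp add: y_def)
  \<comment> \<open>The distance from \<open>t\<close> to the lattice generated by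
    \<open>ln lam\<close>; the whole space then refutes that \<open>t\<close> is essential.\<close>
  define \<epsilon> where "\<epsilon> = min (y - of_int \<lfloor>y\<rfloor>) (of_int \<lfloor>y\<rfloor> + 1 - y) * \<bar>ln lam\<bar>"
  have "y \<noteq> of_int \<lfloor>y\<rfloor>" using no t by metis
  then have "of_int \<lfloor>y\<rfloor> < y" "y < of_int \<lfloor>y\<rfloor> + 1" using of_int_floor_le[of y] floor_correct[of y] by (auto simp: less_le)
  then have \<epsilon>: "0 < \<epsilon>" using L by (simp add: \<epsilon>_def mult_pos_neg)
  have far: "\<epsilon> \<le> \<bar>of_int z * ln lam - t\<bar>" for z :: int
  proof -
    have "min (y - of_int \<lfloor>y\<rfloor>) (of_int \<lfloor>y\<rfloor> + 1 - y) \<le> \<bar>of_int z - y\<bar>"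
    proof (cases "z \<le> \<lfloor>y\<rfloor>")
      case True
      then have "real_of_int z \<le> of_int \<lfloor>y\<rfloor>" by simp
      then show ?thesis by linarith
    next
      case False
      then have "real_of_int (\<lfloor>y\<rfloor> + 1) \<le> of_int z" by (intro of_int_le_iff[THEN iffD2]) simp
      then show ?thesis by simp
    qed
    then have "\<epsilon> \<le> \<bar>of_int z - y\<bar> * \<bar>ln lam\<bar>" unfolding \<epsilon>_def by (intro mult_right_mono) auto
    also have "\<dots> = \<bar>of_int z * ln lam - t\<bar>" by (simp add: t abs_mult[symmetric] left_diff_distrib)
    finally show ?thesis .
  qed
  have "emeasure M (space M) > 0" by (simp add: MM.emeasure_space_1)
  with assms \<epsilon> obtain n where
    n: "0 < emeasure M (space M \<inter> T n -` space M \<inter> {x \<in> space M. \<bar>log_derivative M T n x - t\<bar> < \<epsilon>})" (is "0 < emeasure M ?S")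
    unfolding essential_value_def by blast
  have "emeasure M {x \<in> space M. x \<in> ?S} = 0"
  proof (rule emeasure_eq_0_AE)
    show "AE x in M. x \<notin> ?S"
      using AE_log_derivative[of n]
    proof eventually_elim
      case (elim x)
      then obtain z :: int where "log_derivative M T n x = of_int z * ln lam" ..
      then show ?case using far[of z] by auto
    qed
  qed
  moreover have "{x \<in> space M. x \<in> ?S} = ?S" by auto
  ultimately show False using n by simp
qed

lemma type_III: "type_III_map lam M left_shift"
  unfolding type_III_map_def type_III_action_def krieger_ratio_set_def
  using lam nonsingular ergodic essential_value_powi essential_value_only by auto

end

section \<open>Choice of the parameters\<close>

text \<open>Mass and window position are defined jointly, since each depends on both at the previous
  level. The factor \<open>1 / 8\<close> yields geometric decay, and the remaining factor yields
  \<open>small\<close>.\<close>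

primrec scales :: "real \<Rightarrow> nat \<Rightarrow> real \<times> nat" where
  "scales lam 0 = (1 / 64, 1)"
| "scales lam (Suc k) =
     (let m = fst (scales lam k); N = snd (scales lam k); l = nat \<lceil>1 / m\<rceil>; d = 2 * (N + l) + 1;
          g = (m * lam ^ k) ^ d; s = nat \<lceil>1 / g\<rceil>
      in (m / 8 * (g\<^sup>2 / (50 * (real d * real s))), N + l + d * s + 1))"

lemma ceiling_inverse: assumes "0 < (x::real)" shows "1 \<le> x * nat \<lceil>1 / x\<rceil>" "1 \<le> nat \<lceil>1 / x\<rceil>"
proof -
  have "1 / x \<le> real (nat \<lceil>1 / x\<rceil>)" by linarith
  then have "x * (1 / x) \<le> x * nat \<lceil>1 / x\<rceil>" using assms by (intro mult_left_mono) auto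
  then show "1 \<le> x * nat \<lceil>1 / x\<rceil>" using assms by simp
  have "0 < \<lceil>1 / x\<rceil>" using assms by simp
  then show "1 \<le> nat \<lceil>1 / x\<rceil>" by linarith
qed

lemma swap_masses_swap_masses: "swap_masses B j (swap_masses B j i) = i"
  by (cases i rule: symbol_cases) auto

lemma bij_swap_masses: "bij (swap_masses B j)"
  by (rule o_bij[of "swap_masses B j"]) (auto simp: fun_eq_iff swap_masses_swap_masses)

text \<open>Converts decay per triple into decay per symbol.\<close>

lemma third_power_bound: "(1 / 8 :: real) ^ (i div 3) \<le> 4 * (1 / 2) ^ i"
proof -
  have "(1 / 8 :: real) ^ (i div 3) = (1 / 2) ^ (3 * (i div 3))" by (simp add: power_mult power3_eq_cube)
  also have "\<dots> = 4 * (1 / 2) ^ (3 * (i div 3) + 2)" by (simp add: power_add power2_eq_square)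
  also have "\<dots> \<le> 4 * (1 / 2) ^ i" by (intro mult_left_mono power_decreasing) auto
  finally show ?thesis .
qed

lemma exists_lacunary:
  fixes A :: "'a set" and lam :: real
  assumes A: "countable A" "infinite A" and lam: "0 < lam" "lam < 1"
  shows "\<exists>\<rho> idx v m r N l d s B. lacunary A \<rho> idx lam v m r N l d s B"
proof -
  define m where "m k = fst (scales lam k)" for k
  define N where "N k = snd (scales lam k)" for k
  define l where "l k = nat \<lceil>1 / m k\<rceil>" for k
  define d where "d k = 2 * (N k + l k) + 1" for k
  define s where "s k = nat \<lceil>1 / (m k * lam ^ k) ^ d k\<rceil>" for k
  \<comment> \<open>The first component of the inverse pairing function takes every value infinitely
    often and never exceeds its argument.\<close>
  define r where "r k = fst (prod_decode k)" for k
  define B where "B k = {int (N k)..<int (N k + l k)}" for k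
  define G where "G k = ((m k * lam ^ k) ^ d k)\<^sup>2 / (50 * (real (d k) * real (s k)))" for k
  have m_0: "m 0 = 1 / 64" and N_0: "N 0 = 1" by (simp_all add: m_def N_def)
  have mS: "m (Suc k) = m k / 8 * G k" for k
    unfolding G_def s_def d_def l_def by (simp add: m_def N_def Let_def)
  have N_Suc: "N (Suc k) = N k + l k + d k * s k + 1" for k
    unfolding s_def d_def l_def by (simp add: m_def N_def Let_def)
  \<comment> \<open>Stated under the mass bound at level \<open>k\<close>, because the induction
    proving that bound uses it.\<close>
  have step: "0 < m k \<and> m k \<le> 1 / 64 \<Longrightarrow> 0 < G k \<and> G k \<le> 1 \<and> 1 \<le> s k * (m k * lam ^ k) ^ d k \<and>
      50 * (m k / 8 * G k) * (d k * s k) \<le> ((m k * lam ^ k) ^ d k)\<^sup>2" for k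
  proof -
    assume mk: "0 < m k \<and> m k \<le> 1 / 64"
    let ?g = "(m k * lam ^ k) ^ d k"
    have b: "0 < m k * lam ^ k" "m k * lam ^ k \<le> 1"
      using mk lam mult_le_one[of "m k" "lam ^ k"] by (auto simp: power_le_one)
    then have g: "0 < ?g" "?g \<le> 1" by (simp_all add: power_le_one del: power_mult_distrib)
    have s: "1 \<le> ?g * s k" "1 \<le> s k" using ceiling_inverse[OF g(1)] by (simp_all only: s_def)
    have ds: "1 \<le> real (d k) * real (s k)"
      using s(2) mult_mono[of 1 "real (d k)" 1 "real (s k)"] by (simp add: d_def)
    have G: "0 < G k" unfolding G_def using b(1) ds by (intro divide_pos_pos zero_less_power) linarith+
    have cancel: "50 * x * (y / (50 * x)) = y" if "1 \<le> x" for x y :: real using that by simp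
    have eq: "50 * real (d k * s k) * G k = ?g\<^sup>2" unfolding G_def of_nat_mult by (rule cancel[OF ds])
    have g2: "?g\<^sup>2 \<le> 1" using b by (intro power_le_one) auto
    have "1 * G k \<le> 50 * real (d k * s k) * G k" using G ds by (intro mult_right_mono) auto
    then have "G k \<le> 1" using eq g2 by linarith
    moreover have "50 * (m k / 8 * G k) * (d k * s k) \<le> ?g\<^sup>2"
    proof -
      have "50 * (m k / 8 * G k) * (d k * s k) = m k / 8 * ?g\<^sup>2"
        unfolding eq[symmetric] by (simp only: mult_ac divide_inverse)
      also have "\<dots> \<le> 1 * ?g\<^sup>2" using mk by (intro mult_right_mono) auto
      finally show ?thesis by simp
    qed
    moreover have "1 \<le> s k * ?g" using s(1) by (simp only: mult.commute)
    ultimately show ?thesis using G by blast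
  qed
  have mk: "0 < m k \<and> m k \<le> 1 / 64" for k
  proof (induction k)
    case (Suc k)
    have "m k / 8 * G k \<le> m k / 8 * 1" using step[OF Suc] Suc by (intro mult_left_mono) auto
    moreover have "0 < m k / 8 * G k" using step[OF Suc] Suc by (intro mult_pos_pos) auto
    ultimately show ?case using Suc unfolding mS by linarith
  qed (simp add: m_0)
  note step = step[OF mk]
  have m_Suc: "m (Suc k) \<le> m k / 8" for k
    unfolding mS using mk[of k] step[of k] mult_left_mono[of "G k" 1 "m k / 8"] by simp
  have m_pow: "m k \<le> (1 / 64) * (1 / 8) ^ k" for k
  proof (induction k)
    case (Suc k) then show ?case using m_Suc[of k] by simp
  qed (simp add: m_0)

  \<comment> \<open>Masses of the symbols from 1 on; residue 1 is the second symbol of a triple,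
    because the index is lowered by one.\<close>
  define f where "f i = m (i div 3) * (if i mod 3 = 1 then lam ^ r (i div 3) else 1)" for i
  have f_nonneg: "0 \<le> f i" for i using mk[of "i div 3"] lam by (simp add: f_def less_imp_le)
  have f_le: "f i \<le> 1 / 16 * (1 / 2) ^ i" for i
  proof -
    have "f i \<le> m (i div 3) * 1"
      unfolding f_def using mk[of "i div 3"] lam by (intro mult_left_mono) (auto simp: power_le_one)
    also have "\<dots> \<le> 1 / 64 * (4 * (1 / 2) ^ i)"
      using m_pow[of "i div 3"] third_power_bound[of i] by linarith
    finally show ?thesis by simp
  qed
  have geo: "(\<lambda>i. 1 / 16 * (1 / 2 :: real) ^ i) sums (1 / 16 * (1 / (1 - 1 / 2)))"
    by (intro sums_mult geometric_sums) simp
  have f_sum: "summable f"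
    by (rule summable_comparison_test[OF _ sums_summable[OF geo]]) (use f_nonneg f_le in auto)
  have f_half: "suminf f \<le> 1 / 2"
    using suminf_le[OF f_le f_sum sums_summable[OF geo]] sums_unique[OF geo] by simp
  \<comment> \<open>Symbol 0 receives the remaining mass, at least one half.\<close>
  define v where "v i = (case i of 0 \<Rightarrow> 1 - suminf f | Suc t \<Rightarrow> f t)" for i
  have v_nonneg: "0 \<le> v i" for i using f_nonneg f_half by (auto simp: v_def split: nat.split)
  have v_sums: "v sums 1"
  proof -
    have "(\<lambda>i. v (Suc i)) sums (1 - v 0)" using f_sum by (simp add: v_def summable_sums)
    then show ?thesis by (simp add: sums_Suc_iff)
  qed
  define \<nu> where "\<nu> = embed_pmf v"
  have pmf_nu: "pmf \<nu> i = v i" for i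
    unfolding \<nu>_def
  proof (rule pmf_embed_pmf)
    have "(\<integral>\<^sup>+ i. ennreal (v i) \<partial>count_space UNIV) = (\<Sum>i. ennreal (v i))"
      by (rule nn_integral_count_space_nat)
    also have "\<dots> = ennreal 1"
      using v_sums v_nonneg by (subst suminf_ennreal2) (auto simp: sums_iff)
    finally show "(\<integral>\<^sup>+ i. ennreal (v i) \<partial>count_space UNIV) = 1" by simp
  qed (rule v_nonneg)

  have bij: "bij_betw (to_nat_on A) A UNIV" using A by (rule to_nat_on_infinite)
  have e_in: "from_nat_into A i \<in> A" for i using A(2) by (intro from_nat_into) auto
  define \<rho> where "\<rho> j = distr (measure_pmf (map_pmf (swap_masses B j) \<nu>)) (count_space A) (from_nat_into A)" for j
  have meas: "from_nat_into A \<in> measurable (measure_pmf P) (count_space A)" for P :: "nat pmf"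
    using e_in by (auto simp: measurable_def)
  have prob: "prob_measure_on A (\<rho> j)" for j
    unfolding prob_measure_on_def \<rho>_def
    by (auto intro!: prob_space.prob_space_distr measure_pmf.prob_space_axioms meas)
  have mass: "measure (\<rho> j) {a} = v (swap_masses B j (to_nat_on A a))" if a: "a \<in> A" for j a
  proof -
    have "from_nat_into A -` {a} = {to_nat_on A a}"
      using A a to_nat_on_from_nat_into_infinite[OF A] from_nat_into_to_nat_on[OF A(1) a] by auto
    then have "measure (\<rho> j) {a} = pmf (map_pmf (swap_masses B j) \<nu>) (to_nat_on A a)"
      unfolding \<rho>_def using a by (subst measure_distr[OF meas]) (auto simp: measure_pmf_single)
    \<comment> \<open>The exchange is an involution, so the pushed-forward mass at a symbol is the
      original mass at its partner.\<close>
    also have "\<dots> = pmf (map_pmf (swap_masses B j) \<nu>) (swap_masses B j (swap_masses B j (to_nat_on A a)))" by (simp only: swap_masses_swap_masses)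
    also have "\<dots> = pmf \<nu> (swap_masses B j (to_nat_on A a))"
      by (rule pmf_map_inj') (use bij_swap_masses in \<open>auto simp: bij_def\<close>)
    finally show ?thesis by (simp add: pmf_nu)
  qed
  have "lacunary A \<rho> (to_nat_on A) lam v m r N l d s B"
  proof
    have md: "Suc (3 * k) div 3 = k" "Suc (3 * k) mod 3 = 1" "Suc (Suc (3 * k)) div 3 = k" "Suc (Suc (3 * k)) mod 3 = 2" for k
      by presburger+
    show "v (Suc (3 * k)) = m k" "v (Suc (Suc (3 * k))) = m k * lam ^ r k" "v (Suc (Suc (Suc (3 * k)))) = m k" for k
      by (simp_all add: v_def f_def md)
    show "1 / 2 \<le> v 0" using f_half by (simp add: v_def)
    show "r k \<le> k" for k
      using le_prod_encode_1[of "fst (prod_decode k)" "snd (prod_decode k)"] by (simp add: r_def)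
    show "\<exists>k\<ge>K. r k = n" for n K
      by (intro exI[of _ "prod_encode (n, K)"]) (simp add: r_def le_prod_encode_2)
    show "1 \<le> m k * real (l k)" for k using ceiling_inverse(1)[of "m k"] mk[of k] by (simp add: l_def)
    show "1 \<le> real (s k) * (m k * lam ^ k) ^ d k" for k using step[of k] by blast
    show "50 * m (Suc k) * real (d k * s k) \<le> ((m k * lam ^ k) ^ d k)\<^sup>2" for k
      unfolding mS using step[of k] by blast
    show "m 0 \<le> 1 / 2" by (simp add: m_0)
    show "N (Suc k) = N k + l k + d k * s k + 1" for k by (rule N_Suc)
  qed (use A lam prob bij mass mk m_Suc in \<open>auto simp: N_0 d_def B_def\<close>)
  then show ?thesis by blast
qed

theorem theorem2:
  fixes A :: "'a set" and lam :: real
  assumes "countable A" and "infinite A"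
    and "0 < lam" and "lam < 1"
  shows "\<exists>\<rho> :: int \<Rightarrow> 'a measure.
           (\<forall>n. prob_measure_on A (\<rho> n)) \<and>
           type_III_map lam (bernoulli_space \<rho>) left_shift"
proof -
  obtain \<rho> :: "int \<Rightarrow> 'a measure" and idx v m r N l d s B where "lacunary A \<rho> idx lam v m r N l d s B"
    using exists_lacunary[OF assms] by blast
  then interpret lacunary A \<rho> idx lam v m r N l d s B .
  show ?thesis using prob type_III by blast
qed

end
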